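(* Let $q_1$ be a power of $2$, $q=q_1^2$, and let $m$ be even. Let $n=q^m-1$ and let $\beta$ be a primitive $n$-th root of unity in $\mathbb{F}_{q^m}$. Put $\delta=q_1^{m+1}-q_1^2+1$ and assume $\delta\ge 2$. Let $g(x)$ be the generator polynomial of the BCH code $\mathcal{C}_{(q,n,\delta,1,\beta)}$ and $g^{\perp_H}(x)$ the generator polynomial of its Hermitian dual $\mathcal{C}_{(q,n,\delta,1,\beta)}^{\perp_H}$. Let $\mathcal{C}'$ denote the cyclic code of length $2n$ over $\mathbb{F}_q$ with generator polynomial $g(x)g^{\perp_H}(x)$. Then $\mathcal{C}'$ is a Hermitian self-dual cyclic code with parameters $[2n,n,d]_q$, where $$d=\min\{2d(\mathcal{C}_{(q,n,\delta,1,\beta)}),\,d(\mathcal{C}_{(q,n,\delta,1,\beta)}^\perp)\}\ge q_1^{m+1}-q_1^2+1,$$ and $\mathcal{C}_{(q,n,\delta,1,\beta)}^\perp$ denotes the Euclidean dual.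
   Context: An $[n,k,d]_q$ code is a $k$-dimensional linear subspace of $\mathbb{F}_q^n$ with minimum Hamming distance $d$; $d(\mathcal{C})$ denotes the minimum Hamming distance of $\mathcal{C}$. The Euclidean dual is $\mathcal{C}^\perp=\{c\in\mathbb{F}_q^n:\sum_i c_iy_i=0\ \forall y\in\mathcal{C}\}$. For $q=q_1^2$, the Hermitian inner product on $\mathbb{F}_q^n$ is $\langle x,y\rangle_H=\sum_i x_iy_i^{q_1}$, the Hermitian dual is $\mathcal{C}^{\perp_H}=\{c\in\mathbb{F}_q^n:\langle c,y\rangle_H=0\ \forall y\in\mathcal{C}\}$, and $\mathcal{C}$ is Hermitian self-dual if $\mathcal{C}=\mathcal{C}^{\perp_H}$. A cyclic code of length $N$ over $\mathbb{F}_q$ is identified with an ideal of $\mathbb{F}_q[x]/\langle x^N-1\rangle$ via $(c_0,\dots,c_{N-1})\mapsto c_0+c_1x+\dots+c_{N-1}x^{N-1}$; its generator polynomial is the unique monic divisor of $x^N-1$ generating it. For $\gcd(n,q)=1$ and $\beta$ a primitive $n$-th root of unity, $m_{\beta^i}(x)$ denotes the minimal polynomial of $\beta^i$ over $\mathbb{F}_q$. For integers $\delta\ge2$ and $b$, the BCH code $\mathcal{C}_{(q,n,\delta,b,\beta)}$ is the cyclic code of length $n$ over $\mathbb{F}_q$ with generator polynomial $\mathrm{lcm}\{m_{\beta^b}(x),\dots,m_{\beta^{b+\delta-2}}(x)\}$. *)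

theory Defs
  imports
    "HOL-Computational_Algebra.Polynomial"
    "HOL-Library.Function_Algebras"
    "HOL-Library.Cardinality"
    "HOL-Algebra.Ideal"
begin

section \<open>Words, linear codes and duals\<close>

text \<open>
  The space of words of length \<open>n\<close> over a field consists of the functions on \<open>nat\<close> that
  vanish outside \<open>{..<n}\<close>; addition is the pointwise one from \<open>Function_Algebras\<close>.
\<close>

definition words :: "nat \<Rightarrow> (nat \<Rightarrow> 'a::zero) set" where
  "words n = {v. \<forall>i\<ge>n. v i = 0}"

definition scale_word :: "'a::field \<Rightarrow> (nat \<Rightarrow> 'a) \<Rightarrow> nat \<Rightarrow> 'a" where
  "scale_word a v = (\<lambda>i. a * v i)"

global_interpretation word_space: vector_space scale_word
  by standard (auto simp: scale_word_def fun_eq_iff algebra_simps)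

definition hamming_dist :: "nat \<Rightarrow> (nat \<Rightarrow> 'a) \<Rightarrow> (nat \<Rightarrow> 'a) \<Rightarrow> nat" where
  "hamming_dist n x y = card {i. i < n \<and> x i \<noteq> y i}"

text \<open>For a code with at most one word the value is the junk value \<open>Inf {} = 0\<close>.\<close>

definition min_dist :: "nat \<Rightarrow> (nat \<Rightarrow> 'a) set \<Rightarrow> nat" where
  "min_dist n C = Inf {hamming_dist n x y | x y. x \<in> C \<and> y \<in> C \<and> x \<noteq> y}"

definition linear_code :: "nat \<Rightarrow> nat \<Rightarrow> nat \<Rightarrow> (nat \<Rightarrow> 'a::field) set \<Rightarrow> bool" where
  "linear_code n k d C \<longleftrightarrow>
     C \<subseteq> words n \<and> word_space.subspace C \<and> word_space.dim C = k \<and> min_dist n C = d"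

definition euclidean_dual :: "nat \<Rightarrow> (nat \<Rightarrow> 'a::field) set \<Rightarrow> (nat \<Rightarrow> 'a) set" where
  "euclidean_dual n C = {c \<in> words n. \<forall>y\<in>C. (\<Sum>i<n. c i * y i) = 0}"

text \<open>In the Hermitian notions the parameter \<open>r\<close> is the square root of the field size.\<close>

definition hermitian_prod :: "nat \<Rightarrow> nat \<Rightarrow> (nat \<Rightarrow> 'a::field) \<Rightarrow> (nat \<Rightarrow> 'a) \<Rightarrow> 'a" where
  "hermitian_prod r n x y = (\<Sum>i<n. x i * y i ^ r)"

definition hermitian_dual :: "nat \<Rightarrow> nat \<Rightarrow> (nat \<Rightarrow> 'a::field) set \<Rightarrow> (nat \<Rightarrow> 'a) set" where
  "hermitian_dual r n C = {c \<in> words n. \<forall>y\<in>C. hermitian_prod r n c y = 0}"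

definition hermitian_self_dual :: "nat \<Rightarrow> nat \<Rightarrow> (nat \<Rightarrow> 'a::field) set \<Rightarrow> bool" where
  "hermitian_self_dual r n C \<longleftrightarrow> C = hermitian_dual r n C"


section \<open>Cyclic codes\<close>

definition cyc_modulus :: "nat \<Rightarrow> 'a::field poly" where
  "cyc_modulus N = monom 1 N - 1"

text \<open>
  The ring \<open>F[x]/(x^N - 1)\<close>, each class being represented by its remainder modulo \<open>x^N - 1\<close>.
\<close>

definition cyc_ring :: "nat \<Rightarrow> 'a::field poly ring" where
  "cyc_ring N =
     \<lparr>carrier = {f. f mod cyc_modulus N = f},
      monoid.mult = (\<lambda>f g. (f * g) mod cyc_modulus N),
      one = 1 mod cyc_modulus N,
      zero = 0,
      add = (+)\<rparr>"

definition word_poly :: "nat \<Rightarrow> (nat \<Rightarrow> 'a::field) \<Rightarrow> 'a poly" where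
  "word_poly N c = (\<Sum>i<N. monom (c i) i)"

definition cyclic_code :: "nat \<Rightarrow> (nat \<Rightarrow> 'a::field) set \<Rightarrow> bool" where
  "cyclic_code N C \<longleftrightarrow> C \<subseteq> words N \<and> ideal (word_poly N ` C) (cyc_ring N)"

text \<open>
  The reduction of \<open>g\<close> matters only for \<open>g = x^N - 1\<close>, the generator of the zero code.
\<close>

definition is_generator_poly :: "nat \<Rightarrow> (nat \<Rightarrow> 'a::field) set \<Rightarrow> 'a poly \<Rightarrow> bool" where
  "is_generator_poly N C g \<longleftrightarrow>
     lead_coeff g = 1 \<and> g dvd cyc_modulus N \<and>
     word_poly N ` C = PIdl\<^bsub>cyc_ring N\<^esub> (g mod cyc_modulus N)"

definition generator_poly :: "nat \<Rightarrow> (nat \<Rightarrow> 'a::field) set \<Rightarrow> 'a poly" where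
  "generator_poly N C = (THE g. is_generator_poly N C g)"

definition code_generated_by :: "nat \<Rightarrow> 'a::field poly \<Rightarrow> (nat \<Rightarrow> 'a) set" where
  "code_generated_by N g =
     {c \<in> words N. word_poly N c \<in> PIdl\<^bsub>cyc_ring N\<^esub> (g mod cyc_modulus N)}"


section \<open>BCH codes\<close>

definition field_embedding :: "('a::field \<Rightarrow> 'b::field) \<Rightarrow> bool" where
  "field_embedding \<iota> \<longleftrightarrow>
     \<iota> 1 = 1 \<and> (\<forall>x y. \<iota> (x + y) = \<iota> x + \<iota> y) \<and> (\<forall>x y. \<iota> (x * y) = \<iota> x * \<iota> y)"

definition primitive_root_of_unity :: "nat \<Rightarrow> 'b::field \<Rightarrow> bool" where
  "primitive_root_of_unity n \<beta> \<longleftrightarrow> 0 < n \<and> \<beta> ^ n = 1 \<and> (\<forall>k. 0 < k \<and> k < n \<longrightarrow> \<beta> ^ k \<noteq> 1)"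

text \<open>
  The minimal polynomial of \<open>b\<close> over the field embedded by \<open>\<iota>\<close>: the monic polynomial of
  least degree having \<open>b\<close> as a root.
\<close>

definition min_poly :: "('a::field \<Rightarrow> 'b::field) \<Rightarrow> 'b \<Rightarrow> 'a poly" where
  "min_poly \<iota> b = (THE p. lead_coeff p = 1 \<and> poly (map_poly \<iota> p) b = 0 \<and>
     (\<forall>f. f \<noteq> 0 \<and> poly (map_poly \<iota> f) b = 0 \<longrightarrow> degree p \<le> degree f))"

text \<open>
  The monic least common multiple. The library's \<open>Lcm\<close> on polynomials is not used because it
  needs a gcd structure on the coefficient type, which class \<open>field\<close> does not provide.
\<close>

definition monic_lcm :: "'a::field poly set \<Rightarrow> 'a poly" where
  "monic_lcm S = (THE p. lead_coeff p = 1 \<and> (\<forall>f\<in>S. f dvd p) \<and>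
     (\<forall>h. (\<forall>f\<in>S. f dvd h) \<longrightarrow> p dvd h))"

text \<open>
  The BCH code of length \<open>n\<close> and designed distance \<open>\<delta>\<close> starting at exponent \<open>b\<close>. The field
  size is that of the type \<open>'a\<close>, and \<open>\<iota>\<close> embeds it into a field containing \<open>\<beta>\<close>.
\<close>

definition bch_code ::
    "('a::field \<Rightarrow> 'b::field) \<Rightarrow> nat \<Rightarrow> int \<Rightarrow> int \<Rightarrow> 'b \<Rightarrow> (nat \<Rightarrow> 'a) set" where
  "bch_code \<iota> n \<delta> b \<beta> =
     code_generated_by n (monic_lcm ((\<lambda>i. min_poly \<iota> (\<beta> powi i)) ` {b..b + \<delta> - 2}))"

end

theory Submission
  imports Defs
begin

text \<open>
  Write \<open>C = \<langle>g\<rangle>\<close> for the BCH code and \<open>g h = x^n - 1\<close>. The generator of the Hermitian dual is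
  the conjugate reciprocal of \<open>h\<close> up to a unit, and conjugate reciprocation interchanges the two
  factors of \<open>(x^n - 1)^2 = (g g\<^sub>H)(h h\<^sub>H)\<close> up to units, whence \<open>C'\<close> is self-dual. The designed
  distance is small enough that no zero of \<open>g\<close> becomes another one under \<open>z \<mapsto> z^(-q\<^sub>1)\<close>, so the
  Hermitian dual is contained in \<open>C\<close>, that is \<open>g\<close> divides \<open>g\<^sub>H\<close>. Since \<open>n\<close> is odd and the
  characteristic is two, \<open>C'\<close> is up to a permutation of coordinates the \<open>(u | u + v)\<close>
  construction from \<open>C\<close> and its Hermitian dual. This gives the formula for \<open>d\<close>, and the BCH bound
  applies to both constituents.
\<close>

section \<open>Ring homomorphisms on coefficients\<close>

text \<open>Codewords have coefficients in \<open>'a\<close>, while roots live in \<open>'b\<close>.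
  Instead of factoring \<open>g\<close> over \<open>'b\<close>, the proof uses that
  \<open>g dvd f\<close> means vanishing of \<open>f\<close> at \<open>\<beta> ^ j\<close> for
  \<open>1 \<le> j \<le> \<delta> - 1\<close>. The one argument that needs every root of
  \<open>g\<close> encloses them in a Frobenius-stable set. The notion
  \<open>field_embedding\<close> covers both \<open>\<iota>\<close> and the conjugation
  \<open>z ^ r\<close>, so one set of coefficient lemmas serves extension of scalars and
  conjugation. The constant \<open>\<delta>\<close> is tuned to a telescoping product: with
  \<open>r = q\<^sub>1\<close>, \<open>\<delta> - 1 = r^2 (r^(m-1) - 1)\<close>, and multiplying by
  \<open>1 + r^(m-1)\<close> gives \<open>r^(2m) - r^2\<close>, just below \<open>n\<close>.
  Evenness of \<open>m\<close> matters because conjugation contributes an odd power of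
  \<open>r\<close> and the cyclotomic cosets contribute even ones; the resulting odd exponent cannot
  be \<open>m\<close>, the middle case in which neither it nor its complement \<open>2m - a\<close>
  is below \<open>m\<close>. The Euclidean dual can appear in the formula for \<open>d\<close>
  because coordinatewise conjugation matches it with the Hermitian dual.\<close>

context
  fixes f :: "'a::field \<Rightarrow> 'b::field"
  assumes f: "field_embedding f"
begin

lemma field_embedding_add: "f (x + y) = f x + f y"
  and field_embedding_mult: "f (x * y) = f x * f y"
  and field_embedding_1: "f 1 = 1"
  using f by (auto simp: field_embedding_def)

lemma field_embedding_0: "f 0 = 0"
  using field_embedding_add[of 0 0] by (metis add.right_neutral add_left_cancel)

lemma field_embedding_uminus: "f (- x) = - f x"
  using field_embedding_add[of x "- x"] by (simp add: field_embedding_0 add_eq_0_iff2)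

lemma field_embedding_diff: "f (x - y) = f x - f y"
  using field_embedding_add[of x "- y"] by (simp add: field_embedding_uminus)

lemma field_embedding_power: "f (x ^ k) = f x ^ k"
  by (induction k) (simp_all add: field_embedding_1 field_embedding_mult)

lemma field_embedding_sum: "f (sum h A) = (\<Sum>x\<in>A. f (h x))"
  by (induction A rule: infinite_finite_induct) (simp_all add: field_embedding_0 field_embedding_add)

lemma field_embedding_eq_0_iff: "f x = 0 \<longleftrightarrow> x = 0"
proof
  assume "f x = 0"
  then have "f (x * inverse x) = 0" by (simp add: field_embedding_mult)
  then show "x = 0" by (metis field_embedding_1 right_inverse zero_neq_one)
qed (simp add: field_embedding_0)

lemma field_embedding_inj: "inj f"
  by (rule injI) (metis eq_iff_diff_eq_0 field_embedding_diff field_embedding_eq_0_iff)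

lemma coeff_map_poly_embedding: "coeff (map_poly f p) i = f (coeff p i)"
  by (simp add: coeff_map_poly field_embedding_0)

lemma degree_map_poly_embedding: "degree (map_poly f p) = degree p"
  by (simp add: degree_map_poly field_embedding_eq_0_iff)

lemma map_poly_embedding_eq_0_iff: "map_poly f p = 0 \<longleftrightarrow> p = 0"
  by (simp add: poly_eq_iff coeff_map_poly_embedding field_embedding_eq_0_iff)

lemma map_poly_embedding_diff: "map_poly f (p - p') = map_poly f p - map_poly f p'"
  by (simp add: poly_eq_iff coeff_map_poly_embedding field_embedding_diff)

lemma map_poly_embedding_mult: "map_poly f (p * p') = map_poly f p * map_poly f p'"
  by (simp add: poly_eq_iff coeff_map_poly_embedding coeff_mult field_embedding_sum
      field_embedding_mult)

lemma map_poly_embedding_prod: "map_poly f (prod h A) = (\<Prod>x\<in>A. map_poly f (h x))"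
  by (induction A rule: infinite_finite_induct)
     (simp_all add: field_embedding_1 map_poly_embedding_mult)

lemma map_poly_embedding_dvd: "p dvd p' \<Longrightarrow> map_poly f p dvd map_poly f p'"
  by (auto simp: map_poly_embedding_mult)

lemma poly_map_poly_embedding: "poly (map_poly f p) (f x) = f (poly p x)"
  by (simp add: poly_altdef degree_map_poly_embedding coeff_map_poly_embedding field_embedding_sum
      field_embedding_mult field_embedding_power)

lemma map_poly_cyc_modulus: "map_poly f (cyc_modulus N) = cyc_modulus N"
  by (simp add: cyc_modulus_def map_poly_embedding_diff map_poly_monom field_embedding_0
      field_embedding_1)

end


section \<open>Words as polynomials\<close>

lemma cyc_modulus_coeff:
  "coeff (cyc_modulus N) i = (if i = N then 1 else 0) - (if i = 0 then 1 else 0)"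
  by (simp add: cyc_modulus_def)

lemma poly_cyc_modulus: "poly (cyc_modulus N) x = x ^ N - 1"
  by (simp add: cyc_modulus_def poly_monom)

lemma degree_cyc_modulus [simp]: "N > 0 \<Longrightarrow> degree (cyc_modulus N :: 'a::field poly) = N"
proof (rule antisym)
  show "degree (cyc_modulus N :: 'a poly) \<le> N"
    by (rule degree_le) (auto simp: cyc_modulus_coeff)
qed (rule le_degree, simp add: cyc_modulus_coeff)

lemma cyc_modulus_nonzero: "N > 0 \<Longrightarrow> (cyc_modulus N :: 'a::field poly) \<noteq> 0"
  by (metis degree_0 degree_cyc_modulus less_irrefl)

lemma mod_cyc_modulus_eq_iff:
  fixes p :: "'a::field poly"
  assumes "N > 0"
  shows "p mod cyc_modulus N = p \<longleftrightarrow> degree p < N"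
proof
  assume "p mod cyc_modulus N = p"
  then have "p = 0 \<or> degree p < degree (cyc_modulus N :: 'a poly)"
    using degree_mod_less[OF cyc_modulus_nonzero[OF assms], of p] by simp
  with assms show "degree p < N" by auto
qed (use assms in \<open>simp add: mod_poly_less\<close>)

lemma coeff_word_poly: "coeff (word_poly N c) i = (if i < N then c i else 0)"
  by (simp add: word_poly_def coeff_sum)

lemma coeff_word_poly_words: "c \<in> words N \<Longrightarrow> coeff (word_poly N c) i = c i"
  by (simp add: coeff_word_poly words_def)

lemma degree_word_poly: "N > 0 \<Longrightarrow> degree (word_poly N c) < N"
  by (rule degree_lessI) (auto simp: coeff_word_poly)

lemma coeff_in_words: "degree p < N \<Longrightarrow> coeff p \<in> words N"
  by (simp add: words_def coeff_eq_0)

lemma word_poly_coeff: "degree p < N \<Longrightarrow> word_poly N (coeff p) = p"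
  by (auto simp: poly_eq_iff coeff_word_poly coeff_eq_0)

lemma word_poly_add: "word_poly N (c + c') = word_poly N c + word_poly N c'"
  by (simp add: poly_eq_iff coeff_word_poly)

lemma word_poly_scale: "word_poly N (scale_word a c) = smult a (word_poly N c)"
  by (simp add: poly_eq_iff coeff_word_poly scale_word_def)


section \<open>Cyclic codes and their generator polynomials\<close>

text \<open>Reduction modulo a multiple of \<open>g\<close> neither creates nor destroys
  divisibility by \<open>g\<close>, so the ideal of the quotient ring becomes plain divisibility
  among remainders. The zero code fits in: for \<open>g = x^N - 1\<close> both sides are
  \<open>{0}\<close>.\<close>

lemma PIdl_cyc_ring:
  fixes g :: "'a::field poly"
  assumes N: "N > 0" and g: "g dvd cyc_modulus N"
  shows "PIdl\<^bsub>cyc_ring N\<^esub> (g mod cyc_modulus N) = {p. degree p < N \<and> g dvd p}"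
    (is "?I = ?D")
proof (intro equalityI subsetI)
  fix p assume "p \<in> ?I"
  then obtain x where p: "p = (x * (g mod cyc_modulus N)) mod cyc_modulus N"
    by (auto simp: cgenideal_def cyc_ring_def)
  have "g dvd p"
    unfolding p using g by (simp add: dvd_mod_iff)
  moreover have "p mod cyc_modulus N = p" by (simp add: p)
  ultimately show "p \<in> ?D" using N by (simp add: mod_cyc_modulus_eq_iff)
next
  fix p assume p: "p \<in> ?D"
  then obtain k where k: "p = g * k" by auto
  have "(k mod cyc_modulus N * (g mod cyc_modulus N)) mod cyc_modulus N = p mod cyc_modulus N"
    by (simp add: mod_mult_eq k mult.commute[of k])
  also have "\<dots> = p"
    using p N by (simp add: mod_cyc_modulus_eq_iff)
  finally have "p = (k mod cyc_modulus N * (g mod cyc_modulus N)) mod cyc_modulus N" ..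
  then show "p \<in> ?I"
    by (auto simp: cgenideal_def cyc_ring_def intro!: exI[of _ "k mod cyc_modulus N"])
qed

lemma code_generated_by_iff:
  assumes "N > 0" and "g dvd cyc_modulus N"
  shows "c \<in> code_generated_by N g \<longleftrightarrow> c \<in> words N \<and> g dvd word_poly N c"
  using assms by (auto simp: code_generated_by_def PIdl_cyc_ring degree_word_poly)

lemma word_poly_image_code:
  assumes "N > 0" and "g dvd cyc_modulus N"
  shows "word_poly N ` code_generated_by N g = {p. degree p < N \<and> g dvd p}"
proof (intro equalityI subsetI)
  fix p assume p: "p \<in> {p. degree p < N \<and> g dvd p}"
  then have "coeff p \<in> code_generated_by N g"
    using assms by (simp add: code_generated_by_iff coeff_in_words word_poly_coeff)
  with p show "p \<in> word_poly N ` code_generated_by N g"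
    by (auto simp: image_iff word_poly_coeff intro!: bexI[of _ "coeff p"])
qed (auto simp: code_generated_by_iff[OF assms] degree_word_poly[OF assms(1)])

lemma cring_cyc_ring:
  assumes N: "N > 0"
  shows "cring (cyc_ring N :: 'a::field poly ring)"
proof (rule cringI)
  show "abelian_group (cyc_ring N :: 'a poly ring)"
  proof (rule abelian_groupI)
    fix x :: "'a poly" assume "x \<in> carrier (cyc_ring N)"
    then show "\<exists>y\<in>carrier (cyc_ring N). y \<oplus>\<^bsub>cyc_ring N\<^esub> x = \<zero>\<^bsub>cyc_ring N\<^esub>"
      by (intro bexI[of _ "- x"]) (auto simp: cyc_ring_def)
  qed (auto simp: cyc_ring_def poly_mod_add_left add_ac)
  show "comm_monoid (cyc_ring N :: 'a poly ring)"
    by (rule comm_monoidI) (auto simp: cyc_ring_def mod_mult_left_eq mod_mult_right_eq mult_ac)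
qed (auto simp: cyc_ring_def poly_mod_add_left distrib_right mod_mult_left_eq)

lemma cyclic_code_generated_by:
  assumes N: "N > 0" and g: "g dvd cyc_modulus N"
  shows "cyclic_code N (code_generated_by N g)"
proof -
  have "g mod cyc_modulus N \<in> carrier (cyc_ring N)" by (simp add: cyc_ring_def)
  from cring.cgenideal_ideal[OF cring_cyc_ring[OF N] this]
  show ?thesis
    using assms by (auto simp: cyclic_code_def word_poly_image_code PIdl_cyc_ring code_generated_by_iff)
qed

lemma is_generator_poly_iff:
  assumes "N > 0"
  shows "is_generator_poly N C g \<longleftrightarrow> lead_coeff g = 1 \<and> g dvd cyc_modulus N \<and>
    word_poly N ` C = {p. degree p < N \<and> g dvd p}"
  using assms by (auto simp: is_generator_poly_def PIdl_cyc_ring)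

section \<open>Uniqueness and normalization of generator polynomials\<close>

lemma dvd_poly_degree_ge_imp_dvd:
  fixes p p' :: "'a::field poly"
  assumes "p dvd p'" "p' \<noteq> 0" "degree p' \<le> degree p"
  shows "p' dvd p"
proof -
  obtain k where k: "p' = p * k" using assms(1) by blast
  with assms have "k \<noteq> 0" "degree k = 0" by (auto simp: degree_mult_eq)
  then have "is_unit k" by (simp add: is_unit_iff_degree)
  then show ?thesis by (simp add: k mult_unit_dvd_iff)
qed

lemma monic_dvd_antisym:
  fixes p p' :: "'a::field poly"
  assumes "p dvd p'" "p' dvd p" "lead_coeff p = 1" "lead_coeff p' = 1"
  shows "p = p'"
proof -
  obtain k where k: "p' = p * k" using assms(1) by blast
  have "p \<noteq> 0" using assms(3) by auto
  with assms(2) have "degree p' \<le> degree p" by (rule dvd_imp_degree_le)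
  moreover have "p' \<noteq> 0" using assms(4) by auto
  ultimately have "degree k = 0" using k by (auto simp: degree_mult_eq)
  then obtain a where "k = [:a:]" by (rule degree_eq_zeroE)
  with k assms show ?thesis by (auto simp: lead_coeff_mult split: if_splits)
qed

lemma is_generator_poly_unique:
  assumes N: "N > 0" and "is_generator_poly N C g" "is_generator_poly N C g'"
  shows "g = g'"
proof -
  have dvd: "h' dvd h" if h: "is_generator_poly N C h" "is_generator_poly N C h'" for h h'
  proof -
    have M: "h dvd cyc_modulus N" "h' dvd cyc_modulus N"
      using h unfolding is_generator_poly_iff[OF N] by blast+
    have eq: "{p. degree p < N \<and> h dvd p} = {p. degree p < N \<and> h' dvd p}"
      using h unfolding is_generator_poly_iff[OF N] by argo
    show ?thesis
    proof (cases "degree h < N")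
      case True
      then have "h \<in> {p. degree p < N \<and> h dvd p}" by simp
      then show ?thesis unfolding eq by simp
    next
      case False
      \<comment> \<open>Here \<open>h\<close> is itself no remainder, so the set cannot be tested at
        \<open>h\<close>. By degree, however, \<open>h\<close> is an associate of
        \<open>x^N - 1\<close>, the generator of the zero code.\<close>
      with N have "cyc_modulus N dvd h"
        by (intro dvd_poly_degree_ge_imp_dvd[OF M(1)] cyc_modulus_nonzero) simp_all
      with M(2) show ?thesis by (rule dvd_trans)
    qed
  qed
  have "lead_coeff g = 1" "lead_coeff g' = 1"
    using assms(2,3) unfolding is_generator_poly_iff[OF N] by blast+
  with dvd[OF assms(3,2)] dvd[OF assms(2,3)] show ?thesis by (rule monic_dvd_antisym)
qed

lemma generator_poly_eqI: "N > 0 \<Longrightarrow> is_generator_poly N C g \<Longrightarrow> generator_poly N C = g"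
  unfolding generator_poly_def by (rule the_equality) (auto intro: is_generator_poly_unique)

lemma is_generator_poly_code:
  "N > 0 \<Longrightarrow> g dvd cyc_modulus N \<Longrightarrow> lead_coeff g = 1 \<Longrightarrow>
    is_generator_poly N (code_generated_by N g) g"
  by (simp add: is_generator_poly_iff word_poly_image_code)

lemma code_generated_by_smult:
  assumes "N > 0" and "g dvd cyc_modulus N" and "a \<noteq> 0"
  shows "code_generated_by N (smult a g) = code_generated_by N g"
  using assms by (auto simp: code_generated_by_iff smult_dvd_iff)

lemma generator_poly_code:
  assumes N: "N > 0" and g: "g dvd cyc_modulus N"
  shows "generator_poly N (code_generated_by N g) = smult (inverse (lead_coeff g)) g"
proof (rule generator_poly_eqI[OF N])
  have "g \<noteq> 0" using g cyc_modulus_nonzero[OF N] by auto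
  then have "is_generator_poly N (code_generated_by N (smult (inverse (lead_coeff g)) g))
      (smult (inverse (lead_coeff g)) g)"
    using N g by (intro is_generator_poly_code) (auto simp: smult_dvd_iff)
  then show "is_generator_poly N (code_generated_by N g) (smult (inverse (lead_coeff g)) g)"
    using N g \<open>g \<noteq> 0\<close> by (simp add: code_generated_by_smult)
qed

lemma subspace_code_generated_by:
  assumes "N > 0" and "g dvd cyc_modulus N"
  shows "word_space.subspace (code_generated_by N g)"
proof (rule word_space.subspaceI)
  show "0 \<in> code_generated_by N g"
    by (simp add: code_generated_by_iff[OF assms] words_def word_poly_def)
next
  fix c c' :: "nat \<Rightarrow> 'a" and a :: 'a
  assume c: "c \<in> code_generated_by N g"
  then show "scale_word a c \<in> code_generated_by N g"
    by (auto simp: code_generated_by_iff[OF assms] word_poly_scale words_def dvd_smult)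
       (simp add: scale_word_def)
  assume "c' \<in> code_generated_by N g"
  with c show "c + c' \<in> code_generated_by N g"
    by (auto simp: code_generated_by_iff[OF assms] word_poly_add words_def)
qed

lemma code_generated_by_mono:
  assumes "N > 0" and "h dvd cyc_modulus N" and "g dvd h"
  shows "code_generated_by N h \<subseteq> code_generated_by N g"
proof
  fix c assume "c \<in> code_generated_by N h"
  then have "c \<in> words N" "h dvd word_poly N c"
    by (simp_all add: code_generated_by_iff[OF assms(1,2)])
  with assms(3) show "c \<in> code_generated_by N g"
    by (simp add: code_generated_by_iff[OF assms(1) dvd_trans[OF assms(3,2)]] dvd_trans)
qed

section \<open>Dual codes\<close>

text \<open>Reflection turns a pairing into a convolution: position \<open>degree f - i\<close> of
  \<open>reflect_poly f\<close> holds \<open>coeff f i\<close>, so matching coefficients all meet at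
  position \<open>degree f\<close>.\<close>

lemma sum_mult_eq_coeff_reflect_poly:
  fixes p f :: "'a::field poly"
  assumes "degree f < N"
  shows "(\<Sum>i<N. coeff p i * coeff f i) = coeff (p * reflect_poly f) (degree f)"
proof -
  have "coeff (p * reflect_poly f) (degree f) = (\<Sum>i\<le>degree f. coeff p i * coeff f i)"
    by (auto simp: coeff_mult coeff_reflect_poly intro!: sum.cong)
  also have "\<dots> = (\<Sum>i<N. coeff p i * coeff f i)"
    using assms by (intro sum.mono_neutral_left) (auto simp: coeff_eq_0)
  finally show ?thesis ..
qed

lemma reflect_poly_monom: "a \<noteq> 0 \<Longrightarrow> reflect_poly (monom a k) = [:a:]"
  by (auto simp: poly_eq_iff coeff_reflect_poly degree_monom_eq coeff_pCons split: nat.splits)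

lemma reflect_poly_cyc_modulus:
  assumes "N > 0"
  shows "reflect_poly (cyc_modulus N) = - (cyc_modulus N :: 'a::field poly)"
  using assms by (auto simp: poly_eq_iff coeff_reflect_poly cyc_modulus_coeff)

text \<open>Guarantees that \<open>reflect_poly\<close> keeps the degree of a divisor of
  \<open>x^N - 1\<close> and is undone by a second reflection; a vanishing constant term would lose
  factors of \<open>x\<close>.\<close>

lemma coeff_0_dvd_cyc_modulus:
  fixes g :: "'a::field poly"
  assumes "N > 0" and "g dvd cyc_modulus N"
  shows "coeff g 0 \<noteq> 0"
proof
  assume "coeff g 0 = 0"
  then have "poly (cyc_modulus N :: 'a poly) 0 = 0"
    using assms(2) by (metis dvdE mult_zero_left poly_0_coeff_0 poly_mult)
  with assms(1) show False by (simp add: poly_cyc_modulus power_0_left)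
qed

text \<open>
  The inner product of a word with the shifts of \<open>g\<close> reads off the coefficients of
  \<open>p * reflect_poly g\<close> at positions \<open>degree g, \<dots>, N - 1\<close>. If these vanish, folding the
  upper coefficients onto the lower ones leaves a multiple of \<open>reflect_poly g\<close> of smaller
  degree, that is \<open>0\<close>.
\<close>

lemma euclidean_dual_code:
  fixes g h :: "'a::field poly"
  assumes N: "N > 0" and gh: "g * h = cyc_modulus N"
  shows "euclidean_dual N (code_generated_by N g) = code_generated_by N (reflect_poly h)"
proof -
  have g: "g dvd cyc_modulus N" and h: "h dvd cyc_modulus N" by (simp_all flip: gh)
  have nz: "g \<noteq> 0" "h \<noteq> 0" using gh cyc_modulus_nonzero[OF N, where ?'a = 'a] by auto
  have deg: "degree g + degree h = N"
    using nz gh N by (metis degree_cyc_modulus degree_mult_eq)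
  define g' h' where "g' = reflect_poly g" and "h' = reflect_poly h"
  have gh': "g' * h' = - cyc_modulus N"
    using gh N by (simp add: g'_def h'_def flip: reflect_poly_mult reflect_poly_cyc_modulus)
  have g'0: "g' \<noteq> 0" and h'0: "h' \<noteq> 0" using nz by (auto simp: g'_def h'_def)
  have deg': "degree g' = degree g" "degree h' = degree h"
    using coeff_0_dvd_cyc_modulus[OF N g] coeff_0_dvd_cyc_modulus[OF N h]
    by (simp_all add: g'_def h'_def)
  have h'dvd: "h' dvd cyc_modulus N"
    using gh' by (metis dvd_minus_iff dvd_triv_right)
  show ?thesis
  proof (intro equalityI subsetI)
    fix c assume c: "c \<in> euclidean_dual N (code_generated_by N g)"
    then have cw: "c \<in> words N" by (simp add: euclidean_dual_def)
    define p where "p = word_poly N c"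
    define s where "s = p * g'"
    have mid: "coeff s i = 0" if i: "degree g \<le> i" "i < N" for i
    proof -
      define f where "f = monom 1 (i - degree g) * g"
      have df: "degree f = i"
        using i nz by (simp add: f_def degree_mult_eq degree_monom_eq)
      have "coeff f \<in> code_generated_by N g"
        using i df by (simp add: code_generated_by_iff[OF N g] coeff_in_words word_poly_coeff)
          (simp add: f_def)
      with c have "(\<Sum>i<N. c i * coeff f i) = 0" by (simp add: euclidean_dual_def)
      then have "(\<Sum>i<N. coeff p i * coeff f i) = 0"
        using cw by (simp add: p_def coeff_word_poly_words)
      moreover have "reflect_poly f = g'"
        by (simp add: f_def g'_def reflect_poly_mult reflect_poly_monom)
      ultimately show ?thesis
        using i df by (simp add: sum_mult_eq_coeff_reflect_poly s_def)
    qed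
    define U where "U = poly_shift N s"
    have high: "coeff s i = 0" if "i \<ge> N + degree g" for i
    proof (rule coeff_eq_0)
      have "degree s \<le> degree p + degree g" unfolding s_def using degree_mult_le[of p g'] deg' by simp
      also have "\<dots> < N + degree g" using degree_word_poly[OF N] by (simp add: p_def)
      finally show "degree s < i" using that by simp
    qed
    define R where "R = s - cyc_modulus N * U"
    have cR: "coeff R i = (if i < degree g then coeff s i + coeff s (N + i) else 0)" for i
    proof -
      have "coeff (cyc_modulus N * U) i = (if i < N then 0 else coeff U (i - N)) - coeff U i"
        by (simp add: cyc_modulus_def left_diff_distrib coeff_monom_mult)
      then show ?thesis
        using mid[of i] high[of i] high[of "N + i"] deg by (simp add: R_def U_def coeff_poly_shift add.commute)
    qed
    have "cyc_modulus N = - (g' * h')" by (simp add: gh')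
    then have Rg: "R = g' * (p + h' * U)"
      by (simp add: R_def s_def algebra_simps)
    have "R = 0"
    proof (rule ccontr)
      assume "R \<noteq> 0"
      have "degree g \<le> degree R"
        using dvd_imp_degree_le[of g' R] Rg \<open>R \<noteq> 0\<close> deg' by simp
      then have "lead_coeff R = 0" by (simp add: cR)
      with \<open>R \<noteq> 0\<close> show False by simp
    qed
    with Rg g'0 have "p = - (h' * U)" by (simp add: add_eq_0_iff2)
    then have "h' dvd p" by simp
    then show "c \<in> code_generated_by N (reflect_poly h)"
      using cw code_generated_by_iff[OF N h'dvd] by (simp add: p_def h'_def)
  next
    fix c assume "c \<in> code_generated_by N (reflect_poly h)"
    then have cw: "c \<in> words N" and "h' dvd word_poly N c"
      using code_generated_by_iff[OF N h'dvd] by (auto simp: h'_def)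
    then obtain a where a: "word_poly N c = h' * a" by blast
    have "(\<Sum>i<N. c i * y i) = 0" if y: "y \<in> code_generated_by N g" for y
    proof (cases "a = 0")
      case True
      then show ?thesis using a coeff_word_poly_words[OF cw] by simp
    next
      case False
      from y have yw: "y \<in> words N" and "g dvd word_poly N y"
        by (auto simp: code_generated_by_iff[OF N g])
      then obtain b where b: "word_poly N y = g * b" by blast
      define f where "f = word_poly N y"
      have df: "degree f < N" by (simp add: f_def degree_word_poly[OF N])
      have "degree h' + degree a < N"
        using degree_word_poly[OF N, of c] False h'0 by (simp add: a degree_mult_eq)
      then have da: "degree a < degree g" using deg deg' by simp
      \<comment> \<open>The pairing becomes a coefficient of \<open>-(x^N - 1)\<close> times
        \<open>a * reflect_poly b\<close> at \<open>degree f < N\<close>. The term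
        \<open>x^N\<close> does not reach down to that position, and the cofactor has too small a
        degree to reach up to it.\<close>
      have "(\<Sum>i<N. c i * y i) = (\<Sum>i<N. coeff (h' * a) i * coeff f i)"
        using cw yw by (simp add: f_def coeff_word_poly_words flip: a)
      also have "\<dots> = coeff (h' * a * reflect_poly f) (degree f)"
        using df by (rule sum_mult_eq_coeff_reflect_poly)
      also have "h' * a * reflect_poly f = - cyc_modulus N * (a * reflect_poly b)"
        by (simp add: f_def b reflect_poly_mult flip: gh' g'_def)
      also have "coeff \<dots> (degree f) = coeff (a * reflect_poly b) (degree f)"
        using df by (simp add: cyc_modulus_def left_diff_distrib coeff_monom_mult)
      also have "\<dots> = 0"
      proof (cases "b = 0")
        case True then show ?thesis by simp
      next
        case False
        then have "degree f = degree g + degree b" using nz by (simp add: f_def b degree_mult_eq)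
        moreover have "degree (a * reflect_poly b) \<le> degree a + degree b"
          using degree_mult_le[of a "reflect_poly b"] degree_reflect_poly_le[of b] by simp
        ultimately show ?thesis using da by (intro coeff_eq_0) simp
      qed
      finally show ?thesis .
    qed
    with cw show "c \<in> euclidean_dual N (code_generated_by N g)"
      by (simp add: euclidean_dual_def)
  qed
qed

text \<open>The Hermitian dual of a code is the Euclidean dual of its coordinatewise conjugate.
  Conjugation takes the code of \<open>g\<close> onto that of the conjugate of \<open>g\<close>: it
  respects divisibility, and by \<open>invol\<close> it is its own inverse.\<close>

lemma hermitian_dual_code:
  fixes g h :: "'a::field poly"
  assumes N: "N > 0" and gh: "g * h = cyc_modulus N"
    and frob: "field_embedding (\<lambda>z::'a. z ^ r)" and invol: "\<And>z::'a. (z ^ r) ^ r = z"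
  shows "hermitian_dual r N (code_generated_by N g) =
    code_generated_by N (reflect_poly (map_poly (\<lambda>z. z ^ r) h))"
proof -
  let ?F = "\<lambda>z::'a. z ^ r"
  let ?g = "map_poly ?F g" and ?h = "map_poly ?F h"
  have eq: "?g * ?h = cyc_modulus N"
    using gh by (simp add: map_poly_cyc_modulus[OF frob] flip: map_poly_embedding_mult[OF frob])
  have g: "g dvd cyc_modulus N" and g': "?g dvd cyc_modulus N"
    using gh eq by (metis dvd_triv_left)+
  have F0: "?F 0 = 0" by (rule field_embedding_0[OF frob])
  have FF: "map_poly ?F (map_poly ?F p) = p" for p
    by (simp add: poly_eq_iff coeff_map_poly_embedding[OF frob] invol)
  have wp: "word_poly N (\<lambda>i. y i ^ r) = map_poly ?F (word_poly N y)" for y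
    by (simp add: poly_eq_iff coeff_word_poly coeff_map_poly_embedding[OF frob] F0)
  have img: "(\<lambda>i. y i ^ r) \<in> code_generated_by N ?g" if "y \<in> code_generated_by N g" for y
    using that F0 map_poly_embedding_dvd[OF frob, of g "word_poly N y"]
    by (simp add: code_generated_by_iff[OF N g] code_generated_by_iff[OF N g'] wp words_def)
  have img': "(\<lambda>i. y i ^ r) \<in> code_generated_by N g" if "y \<in> code_generated_by N ?g" for y
    using that F0 map_poly_embedding_dvd[OF frob, of ?g "word_poly N y"]
    by (simp add: code_generated_by_iff[OF N g] code_generated_by_iff[OF N g'] wp words_def FF)
  have "hermitian_dual r N (code_generated_by N g) = euclidean_dual N (code_generated_by N ?g)"
    unfolding hermitian_dual_def euclidean_dual_def hermitian_prod_def
  proof (intro Collect_cong conj_cong refl iffI ballI)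
    fix c y assume "\<forall>y\<in>code_generated_by N g. (\<Sum>i<N. c i * y i ^ r) = 0"
      and "y \<in> code_generated_by N ?g"
    then show "(\<Sum>i<N. c i * y i) = 0" using img'[of y] by (force simp: invol)
  next
    fix c y assume "\<forall>y\<in>code_generated_by N ?g. (\<Sum>i<N. c i * y i) = 0"
      and "y \<in> code_generated_by N g"
    then show "(\<Sum>i<N. c i * y i ^ r) = 0" using img[of y] by force
  qed
  with euclidean_dual_code[OF N eq] show ?thesis by simp
qed

section \<open>Dimension\<close>

text \<open>The shifts \<open>x^j * g\<close> with \<open>j < N - degree g\<close> form a basis: the
  quotient of a codeword by \<open>g\<close> lists its coordinates, and cancelling \<open>g\<close>
  gives independence.\<close>

lemma dim_code_generated_by:
  fixes g :: "'a::field poly"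
  assumes N: "N > 0" and g: "g dvd cyc_modulus N"
  shows "word_space.dim (code_generated_by N g) = N - degree g"
proof -
  define b where "b = (\<lambda>j. coeff (monom 1 j * g))"
  let ?J = "{..<N - degree g}"
  have nz: "g \<noteq> 0" using g cyc_modulus_nonzero[OF N] by auto
  have dle: "degree g \<le> N"
    using dvd_imp_degree_le[OF g cyc_modulus_nonzero[OF N]] N by simp
  have sum_coeff: "(\<Sum>j\<in>?J. scale_word (u j) (b j)) = coeff ((\<Sum>j\<in>?J. monom (u j) j) * g)" for u
  proof
    fix i
    have "(\<Sum>j\<in>A. scale_word (u j) (b j)) i = coeff ((\<Sum>j\<in>A. monom (u j) j) * g) i" if "finite A" for A
      using that
      by (induction A) (auto simp: scale_word_def b_def distrib_right coeff_monom_mult)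
    then show "(\<Sum>j\<in>?J. scale_word (u j) (b j)) i = coeff ((\<Sum>j\<in>?J. monom (u j) j) * g) i"
      by simp
  qed
  have inj: "inj_on b ?J"
  proof (rule inj_onI)
    fix j k assume "b j = b k"
    then have "monom 1 j * g = monom 1 k * g" by (simp add: b_def coeff_inject)
    with nz have "monom (1::'a) j = monom 1 k" by simp
    then show "j = k" by (metis degree_monom_eq one_neq_zero)
  qed
  show ?thesis
  proof (rule word_space.dim_unique[of "b ` ?J"])
    show "b ` ?J \<subseteq> code_generated_by N g"
    proof clarify
      fix j assume "j < N - degree g"
      then have "degree (monom 1 j * g) < N"
        using nz by (simp add: degree_mult_eq degree_monom_eq)
      then show "b j \<in> code_generated_by N g"
        by (simp add: code_generated_by_iff[OF N g] b_def coeff_in_words word_poly_coeff)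
    qed
    show "code_generated_by N g \<subseteq> word_space.span (b ` ?J)"
    proof
      fix c assume "c \<in> code_generated_by N g"
      then have cw: "c \<in> words N" and "g dvd word_poly N c"
        by (auto simp: code_generated_by_iff[OF N g])
      then obtain k where k: "word_poly N c = k * g" by (metis dvdE mult.commute)
      have kdeg: "coeff k j = 0" if "j \<ge> N - degree g" for j
      proof (cases "k = 0")
        case False
        with nz k have "degree k + degree g < N"
          using degree_word_poly[OF N, of c] by (simp add: degree_mult_eq)
        with that show ?thesis by (intro coeff_eq_0) simp
      qed simp
      have "k = (\<Sum>j\<in>?J. monom (coeff k j) j)"
        by (auto simp: poly_eq_iff coeff_sum kdeg)
      with k have "word_poly N c = (\<Sum>j\<in>?J. monom (coeff k j) j) * g" by simp
      then have "c = (\<Sum>j\<in>?J. scale_word (coeff k j) (b j))"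
        unfolding sum_coeff by (simp add: fun_eq_iff coeff_word_poly_words[OF cw, symmetric])
      also have "\<dots> \<in> word_space.span (b ` ?J)"
        by (intro word_space.span_sum word_space.span_scale word_space.span_base imageI)
      finally show "c \<in> word_space.span (b ` ?J)" .
    qed
    show "word_space.independent (b ` ?J)"
    proof (rule word_space.independent_if_scalars_zero)
      fix u x assume sum0: "(\<Sum>x\<in>b ` ?J. scale_word (u x) x) = 0" and "x \<in> b ` ?J"
      then obtain j where j: "j \<in> ?J" "x = b j" by blast
      have "coeff ((\<Sum>j\<in>?J. monom (u (b j)) j) * g) = (\<lambda>_. 0)"
        using sum0 sum_coeff[of "\<lambda>j. u (b j)"] by (simp add: sum.reindex[OF inj] zero_fun_def)
      then have "(\<Sum>j\<in>?J. monom (u (b j)) j) * g = 0" by (simp add: poly_eq_iff)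
      with nz have "(\<Sum>j\<in>?J. monom (u (b j)) j) = 0" by simp
      then have "coeff (\<Sum>j\<in>?J. monom (u (b j)) j) j = 0" by simp
      with j show "u x = 0" by (simp add: coeff_sum)
    qed simp
    show "card (b ` ?J) = N - degree g" by (simp add: card_image[OF inj])
  qed
qed

section \<open>Minimum distance\<close>

text \<open>No length appears, since words vanish from their length on. For infinite support
  \<open>card\<close> would return \<open>0\<close>, whence
  \<open>finite_support_words\<close>.\<close>

definition weight :: "(nat \<Rightarrow> 'a::zero) \<Rightarrow> nat" where
  "weight c = card {i. c i \<noteq> 0}"

lemma finite_support_words: "c \<in> words n \<Longrightarrow> finite {i. c i \<noteq> 0}"
  by (rule finite_subset[of _ "{..<n}"]) (auto simp: words_def not_le[symmetric])

lemma hamming_dist_eq_weight: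
  fixes x y :: "nat \<Rightarrow> 'a::field"
  assumes "x \<in> words n" "y \<in> words n"
  shows "hamming_dist n x y = weight (x - y)"
proof -
  have "{i. i < n \<and> x i \<noteq> y i} = {i. (x - y) i \<noteq> 0}"
    using assms by (auto simp: words_def not_le[symmetric])
  then show ?thesis by (simp add: hamming_dist_def weight_def)
qed

lemma min_dist_eq_Inf_weight:
  fixes C :: "(nat \<Rightarrow> 'a::field) set"
  assumes "word_space.subspace C" and "C \<subseteq> words n"
  shows "min_dist n C = Inf (weight ` (C - {0}))"
proof -
  have "{hamming_dist n x y | x y. x \<in> C \<and> y \<in> C \<and> x \<noteq> y} = weight ` (C - {0})"
  proof (intro equalityI subsetI)
    fix k assume "k \<in> {hamming_dist n x y | x y. x \<in> C \<and> y \<in> C \<and> x \<noteq> y}"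
    then obtain x y where xy: "k = hamming_dist n x y" "x \<in> C" "y \<in> C" "x \<noteq> y" by blast
    then have "x - y \<in> C - {0}"
      using word_space.subspace_diff[OF assms(1)] by simp
    moreover have "k = weight (x - y)" using xy assms(2) by (auto intro: hamming_dist_eq_weight)
    ultimately show "k \<in> weight ` (C - {0})" by blast
  next
    fix k assume "k \<in> weight ` (C - {0})"
    then obtain x where x: "k = weight x" "x \<in> C" "x \<noteq> 0" by blast
    have "0 \<in> C" using assms(1) by (rule word_space.subspace_0)
    then have "hamming_dist n x 0 = weight (x - 0)"
      by (intro hamming_dist_eq_weight subsetD[OF assms(2)] x)
    then have "k = hamming_dist n x 0"
      using x(1) by (simp only: diff_zero)
    with \<open>0 \<in> C\<close> show "k \<in> {hamming_dist n x y | x y. x \<in> C \<and> y \<in> C \<and> x \<noteq> y}"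
      using x by blast
  qed
  then show ?thesis by (simp add: min_dist_def)
qed

lemma min_dist_le:
  fixes C :: "(nat \<Rightarrow> 'a::field) set"
  assumes "word_space.subspace C" and "C \<subseteq> words n" and "c \<in> C" and "c \<noteq> 0"
  shows "min_dist n C \<le> weight c"
  using assms by (auto simp: min_dist_eq_Inf_weight intro!: cInf_lower)

text \<open>Excluding \<open>{0}\<close> keeps the set of weights nonempty; for the zero code
  \<open>min_dist\<close> is the default \<open>Inf {} = 0\<close>. The degree conditions on
  generators below serve to meet this assumption.\<close>

lemma min_dist_attained:
  fixes C :: "(nat \<Rightarrow> 'a::field) set"
  assumes "word_space.subspace C" and "C \<subseteq> words n" and "C \<noteq> {0}"
  obtains c where "c \<in> C" "c \<noteq> 0" "min_dist n C = weight c"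
proof -
  have "0 \<in> C" using assms(1) by (rule word_space.subspace_0)
  with assms(3) have "weight ` (C - {0}) \<noteq> {}" by blast
  from Inf_nat_def1[OF this] show ?thesis
    using assms that by (auto simp: min_dist_eq_Inf_weight)
qed

lemma code_generated_by_subset_words: "code_generated_by N g \<subseteq> words N"
  by (auto simp: code_generated_by_def)

lemma code_generated_by_nontrivial:
  fixes g :: "'a::field poly"
  assumes N: "N > 0" and g: "g dvd cyc_modulus N" and "degree g < N"
  shows "code_generated_by N g \<noteq> {0}"
proof -
  have "g \<noteq> 0" using g cyc_modulus_nonzero[OF N] by auto
  then have "coeff g \<noteq> 0" by (metis leading_coeff_0_iff zero_fun_def)
  moreover have "coeff g \<in> code_generated_by N g"
    using assms by (simp add: code_generated_by_iff coeff_in_words word_poly_coeff)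
  ultimately show ?thesis by blast
qed


section \<open>Repeated-root cyclic codes in characteristic two\<close>

text \<open>Squarefreeness of \<open>x^n - 1\<close> as a Bezout identity, from \<open>x * f' - n * f = n\<close> for
  \<open>f = x^n - 1\<close>.\<close>

lemma dvd_of_dvd_mult_complement:
  fixes g w k :: "'a::field poly"
  assumes gw: "g * w = cyc_modulus n" and n: "of_nat n \<noteq> (0 :: 'a)"
  shows "g dvd pderiv g * k \<Longrightarrow> g dvd k" and "g dvd w * k \<Longrightarrow> g dvd k"
proof -
  have n0: "n > 0" using n by (cases n) auto
  let ?u = "inverse (of_nat n :: 'a)"
  let ?A = "smult ?u (monom 1 1 * pderiv w) - w"
  have pd: "pderiv (cyc_modulus n :: 'a poly) = monom (of_nat n) (n - 1)"
    by (simp add: cyc_modulus_def pderiv_diff pderiv_monom)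
  have "smult ?u (monom 1 1 * pderiv (cyc_modulus n)) = cyc_modulus n + 1"
    using n n0 unfolding pd by (simp add: mult_monom smult_monom cyc_modulus_def)
  then have "smult ?u (monom 1 1 * pderiv (g * w)) - g * w = 1"
    by (simp add: gw)
  then have bez: "g * ?A + smult ?u (monom 1 1) * (pderiv g * w) = 1"
    by (simp add: pderiv_mult algebra_simps smult_add_right)
  then have "k = g * (?A * k) + smult ?u (monom 1 1) * (pderiv g * w * k)" for k
    by (metis (no_types, opaque_lifting) distrib_right mult.assoc mult_1)
  then have *: "g dvd k" if "g dvd pderiv g * w * k" for k
    by (metis dvd_add dvd_mult dvd_triv_left that)
  show "g dvd pderiv g * k \<Longrightarrow> g dvd k"
    by (rule *) (metis dvd_mult mult.assoc mult.commute)
  show "g dvd w * k \<Longrightarrow> g dvd k"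
    by (rule *) (simp add: mult.assoc)
qed

text \<open>The Leibniz rule on \<open>p = g * k\<close> gives \<open>g dvd pderiv g * k\<close>,
  and \<open>g\<close> is coprime to its derivative. In characteristic two every polynomial in
  \<open>x^2\<close> has derivative zero, so divisibility by \<open>g\<close> doubles for
  it.\<close>

lemma square_dvd_of_pderiv_eq_0:
  fixes g p :: "'a::field poly"
  assumes "g dvd cyc_modulus n" and n: "of_nat n \<noteq> (0 :: 'a)" and p: "g dvd p" "pderiv p = 0"
  shows "g * g dvd p"
proof -
  obtain w where w: "g * w = cyc_modulus n" using assms(1) by (metis dvdE)
  obtain k where k: "p = g * k" using p(1) by blast
  then have "g * pderiv k + k * pderiv g = 0" using p(2) by (simp add: pderiv_mult)
  then have "pderiv g * k = g * - pderiv k" by (simp add: algebra_simps add_eq_0_iff)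
  then have "g dvd pderiv g * k" by simp
  then have "g dvd k" by (rule dvd_of_dvd_mult_complement(1)[OF w n])
  then show ?thesis by (simp add: k)
qed

text \<open>For a word with halves \<open>a\<close> and \<open>b\<close> this is
  \<open>a + x^n b = (a + b) + (x^n - 1) b\<close>. Modulo \<open>x^n - 1\<close> the folded word
  \<open>a + b\<close> remains, and when it vanishes the quotient is the upper half
  \<open>b\<close>.\<close>

lemma word_poly_fold:
  assumes "c \<in> words (2 * n)"
  shows "word_poly (2 * n) c = word_poly n (\<lambda>i. c i + c (i + n)) +
    cyc_modulus n * word_poly n (\<lambda>i. c (i + n))"
proof (rule poly_eqI)
  fix i
  have "coeff (cyc_modulus n * word_poly n (\<lambda>i. c (i + n))) i =
      (if i < n then 0 else coeff (word_poly n (\<lambda>i. c (i + n))) (i - n)) -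
      coeff (word_poly n (\<lambda>i. c (i + n))) i"
    by (simp add: cyc_modulus_def left_diff_distrib coeff_monom_mult)
  then show "coeff (word_poly (2 * n) c) i = coeff (word_poly n (\<lambda>i. c i + c (i + n)) +
      cyc_modulus n * word_poly n (\<lambda>i. c (i + n))) i"
    using assms by (auto simp: coeff_word_poly words_def)
qed

lemma cyc_modulus_double:
  assumes "(2 :: 'a::field) = 0"
  shows "(cyc_modulus (2 * n) :: 'a poly) = cyc_modulus n * cyc_modulus n"
proof -
  have "(2 :: 'a poly) = [:2:]" by (simp add: numeral_poly)
  with assms have 2: "(2 :: 'a poly) = 0" by simp
  have "(X - 1) * (X - 1) = (X * X - 1) - 2 * (X - 1)" for X :: "'a poly"
    by (simp only: left_diff_distrib right_diff_distrib mult_2 mult_1_left mult_1_right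
        diff_diff_eq2 diff_diff_eq) (simp add: add_ac)
  from this[of "monom 1 n"] have "cyc_modulus n * cyc_modulus n = monom 1 n * monom 1 n - (1 :: 'a poly)"
    by (simp only: 2 cyc_modulus_def mult_zero_left diff_zero)
  also have "\<dots> = cyc_modulus (2 * n)"
    by (simp only: mult_monom cyc_modulus_def mult_2 mult_1_left)
  finally show ?thesis ..
qed

text \<open>
  The lower bound folds a word \<open>(c\<^sub>0 | c\<^sub>1)\<close> to \<open>c\<^sub>0 + c\<^sub>1\<close>, which lies in the code of \<open>h\<close>; if
  it vanishes, \<open>c\<^sub>1\<close> lies in the code of \<open>g\<close>. Conversely \<open>(u | u)\<close> is a codeword for every \<open>u\<close>
  in the code of \<open>g\<close>, and a word of the code of \<open>h\<close> can be moved, modulo \<open>x^n - 1\<close>, to even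
  exponents because \<open>n\<close> is odd; there its derivative vanishes, so that \<open>h\<close> divides it twice.
\<close>

lemma min_dist_repeated_root:
  fixes g h :: "'a::field poly"
  assumes two: "(2 :: 'a) = 0" and n: "odd n"
    and g: "g dvd h" and h: "h dvd cyc_modulus n" and nontriv: "degree h < n"
  shows "min_dist (2 * n) (code_generated_by (2 * n) (g * h)) =
    min (2 * min_dist n (code_generated_by n g)) (min_dist n (code_generated_by n h))"
proof -
  define Cg Ch D where "Cg = code_generated_by n g" and "Ch = code_generated_by n h"
    and "D = code_generated_by (2 * n) (g * h)"
  have n0: "n > 0" using n by (cases n) auto
  then have N0: "2 * n > 0" by simp
  have even0: "(of_nat k :: 'a) = 0" if "even k" for k
    using that two by (auto elim!: evenE)
  have ofn: "(of_nat n :: 'a) \<noteq> 0"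
    using n even0 by (auto elim!: oddE simp: two)
  have g': "g dvd cyc_modulus n" using g h by (rule dvd_trans)
  have gh: "g * h dvd cyc_modulus (2 * n)"
    using g' h by (simp add: cyc_modulus_double[OF two] mult_dvd_mono)
  have neg: "- x = x" for x :: 'a
    using two by (metis add.inverse_unique mult_2 mult_zero_left)
  have Cg_iff: "c \<in> Cg \<longleftrightarrow> c \<in> words n \<and> g dvd word_poly n c" for c
    unfolding Cg_def by (rule code_generated_by_iff[OF n0 g'])
  have Ch_iff: "c \<in> Ch \<longleftrightarrow> c \<in> words n \<and> h dvd word_poly n c" for c
    unfolding Ch_def by (rule code_generated_by_iff[OF n0 h])
  have D_iff: "c \<in> D \<longleftrightarrow> c \<in> words (2 * n) \<and> g * h dvd word_poly (2 * n) c" for c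
    unfolding D_def by (rule code_generated_by_iff[OF N0 gh])
  have sub: "word_space.subspace Cg" "word_space.subspace Ch" "word_space.subspace D"
    unfolding Cg_def Ch_def D_def by (rule subspace_code_generated_by; use n0 g' h gh in simp)+
  have wds: "Cg \<subseteq> words n" "Ch \<subseteq> words n" "D \<subseteq> words (2 * n)"
    unfolding Cg_def Ch_def D_def by (rule code_generated_by_subset_words)+
  have Ch0: "Ch \<noteq> {0}"
    unfolding Ch_def by (rule code_generated_by_nontrivial[OF n0 h nontriv])
  have "Ch \<subseteq> Cg"
    unfolding Ch_def Cg_def by (rule code_generated_by_mono[OF n0 h g])
  with Ch0 sub(2) have Cg0: "Cg \<noteq> {0}"
    using word_space.subspace_0 by blast
  have "min (2 * min_dist n Cg) (min_dist n Ch) \<le> weight c" if c: "c \<in> D" "c \<noteq> 0" for c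
  proof -
    define u v where "u = (\<lambda>i. if i < n then c i + c (i + n) else 0)" and "v = (\<lambda>i. c (i + n))"
    have cw: "c \<in> words (2 * n)" and cdvd: "g * h dvd word_poly (2 * n) c"
      using c(1) by (auto simp: D_iff)
    have uw: "u \<in> words n" and vw: "v \<in> words n"
      using cw by (auto simp: u_def v_def words_def)
    have fold: "word_poly (2 * n) c = word_poly n u + cyc_modulus n * word_poly n v"
      using word_poly_fold[OF cw] by (simp add: u_def v_def word_poly_def)
    let ?S0 = "{i. i < n \<and> c i \<noteq> 0}" and ?S1 = "(\<lambda>i. i + n) ` {i. v i \<noteq> 0}"
    have supp: "{i. c i \<noteq> 0} = ?S0 \<union> ?S1"
    proof (intro equalityI subsetI)
      fix i assume "i \<in> {i. c i \<noteq> 0}"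
      then show "i \<in> ?S0 \<union> ?S1"
        by (cases "i < n") (auto simp: v_def image_iff intro!: exI[of _ "i - n"])
    qed (auto simp: v_def)
    have fin: "finite ?S0" "finite {i. v i \<noteq> 0}" using finite_support_words[OF vw] by auto
    have "card {i. c i \<noteq> 0} = card ?S0 + card ?S1"
      unfolding supp using fin by (intro card_Un_disjoint) auto
    moreover have "card ?S1 = weight v" unfolding weight_def by (rule card_image) (simp add: inj_on_def)
    ultimately have wc: "weight c = card ?S0 + weight v" by (simp add: weight_def)
    show ?thesis
    proof (cases "u = 0")
      case False
      have "h dvd word_poly n u"
        using dvd_mult_right[OF cdvd] h unfolding fold by (simp add: dvd_add_left_iff)
      with uw have "u \<in> Ch" by (simp add: Ch_iff)
      with False have "min_dist n Ch \<le> weight u" by (intro min_dist_le sub wds)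
      also have "weight u \<le> card (?S0 \<union> {i. v i \<noteq> 0})"
        unfolding weight_def using fin by (intro card_mono) (auto simp: u_def v_def)
      also have "\<dots> \<le> weight c"
        using card_Un_le[of ?S0 "{i. v i \<noteq> 0}"] by (simp add: wc weight_def[of v])
      finally show ?thesis by simp
    next
      case True
      then have u0: "c i + c (i + n) = 0" if "i < n" for i
        using that by (auto simp: u_def fun_eq_iff split: if_splits)
      have eq: "c i = v i" if "i < n" for i
        using u0[OF that] neg by (simp add: v_def add_eq_0_iff2)
      have S0: "?S0 = {i. v i \<noteq> 0}"
      proof (rule Collect_cong)
        fix i show "i < n \<and> c i \<noteq> 0 \<longleftrightarrow> v i \<noteq> 0"
          using eq[of i] vw by (cases "i < n") (simp_all add: words_def)
      qed
      have wc2: "weight c = 2 * weight v"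
        using wc unfolding S0 weight_def[of v, symmetric] by simp
      have "v \<noteq> 0"
      proof
        assume "v = 0"
        then have "{i. c i \<noteq> 0} = {}" unfolding supp using eq by auto
        with c(2) show False by (auto simp: fun_eq_iff)
      qed
      \<comment> \<open>Cancelling \<open>h\<close> from \<open>g * h dvd (x^n - 1) * v\<close>
        leaves \<open>g dvd k * v\<close>. With \<open>h = g * t\<close> the product
        \<open>t * k\<close> is the complement of \<open>g\<close> in \<open>x^n - 1\<close>, and
        coprimality of \<open>g\<close> to its complement removes it.\<close>
      obtain k where k: "h * k = cyc_modulus n" using h by (metis dvdE)
      have h0: "h \<noteq> 0" using h cyc_modulus_nonzero[OF n0] by auto
      have "h * g dvd h * (k * word_poly n v)"
        using cdvd True unfolding fold by (simp add: word_poly_def mult_ac flip: k)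
      then have "g dvd k * word_poly n v" using h0 by simp
      moreover obtain t where t: "h = g * t" using g by blast
      ultimately have dvd: "g dvd (t * k) * word_poly n v" by (simp add: mult.assoc)
      have gtk: "g * (t * k) = cyc_modulus n" by (simp add: k flip: mult.assoc t)
      from dvd have "g dvd word_poly n v"
        by (rule dvd_of_dvd_mult_complement(2)[OF gtk ofn])
      with vw have "v \<in> Cg" by (simp add: Cg_iff)
      with \<open>v \<noteq> 0\<close> have "min_dist n Cg \<le> weight v" by (intro min_dist_le sub wds)
      then show ?thesis by (simp add: wc2)
    qed
  qed
  moreover have "min_dist (2 * n) D \<le> 2 * min_dist n Cg"
  proof -
    obtain u where u: "u \<in> Cg" "u \<noteq> 0" "min_dist n Cg = weight u"
      using min_dist_attained[OF sub(1) wds(1) Cg0] .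
    define c where "c = (\<lambda>i. if i < n then u i else u (i - n))"
    have uw: "u \<in> words n" using u wds by auto
    then have cw: "c \<in> words (2 * n)" by (auto simp: c_def words_def)
    have double: "u i + u i = 0" for i using two by (metis mult_2 mult_zero_left)
    have "(\<lambda>i. c (i + n)) = u" by (simp add: c_def)
    moreover have "word_poly n (\<lambda>i. c i + c (i + n)) = 0"
      unfolding word_poly_def by (rule sum.neutral) (simp add: c_def double)
    ultimately have "word_poly (2 * n) c = cyc_modulus n * word_poly n u"
      using word_poly_fold[OF cw] by simp
    moreover have "g dvd word_poly n u" using u by (simp add: Cg_iff)
    ultimately have "c \<in> D"
      using cw h by (simp add: D_iff mult.commute[of g] mult_dvd_mono)
    moreover have "c \<noteq> 0"
    proof -
      obtain i where i: "u i \<noteq> 0" using u(2) by (auto simp: fun_eq_iff)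
      with uw have "c i = u i" by (auto simp: c_def words_def not_le[symmetric])
      with i show ?thesis by auto
    qed
    ultimately have "min_dist (2 * n) D \<le> weight c" by (intro min_dist_le sub wds)
    also have "weight c \<le> card ({i. u i \<noteq> 0} \<union> (\<lambda>i. i + n) ` {i. u i \<noteq> 0})"
      unfolding weight_def
    proof (rule card_mono)
      show "{i. c i \<noteq> 0} \<subseteq> {i. u i \<noteq> 0} \<union> (\<lambda>i. i + n) ` {i. u i \<noteq> 0}"
      proof
        fix i assume "i \<in> {i. c i \<noteq> 0}"
        then show "i \<in> {i. u i \<noteq> 0} \<union> (\<lambda>i. i + n) ` {i. u i \<noteq> 0}"
          by (cases "i < n") (auto simp: c_def image_iff intro!: exI[of _ "i - n"])
      qed
    qed (simp add: finite_support_words[OF uw])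
    also have "\<dots> \<le> weight u + card ((\<lambda>i. i + n) ` {i. u i \<noteq> 0})"
      unfolding weight_def by (rule card_Un_le)
    also have "\<dots> \<le> 2 * weight u"
      using card_image_le[OF finite_support_words[OF uw], of "\<lambda>i. i + n"] by (simp add: weight_def)
    finally show ?thesis by (simp add: u)
  qed
  moreover have "min_dist (2 * n) D \<le> min_dist n Ch"
  proof -
    obtain v where v: "v \<in> Ch" "v \<noteq> 0" "min_dist n Ch = weight v"
      using min_dist_attained[OF sub(2) wds(2) Ch0] .
    have vw: "v \<in> words n" using v wds by auto
    define d where "d = (\<lambda>i. if even i \<and> i < 2 * n then v (i mod n) else 0)"
    have dw: "d \<in> words (2 * n)" by (simp add: d_def words_def)
    have "d i + d (i + n) = v i" if "i < n" for i
      using that n by (auto simp: d_def)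
    then have fold: "word_poly (2 * n) d = word_poly n v + cyc_modulus n * word_poly n (\<lambda>i. d (i + n))"
      using word_poly_fold[OF dw] by (simp add: word_poly_def)
    have "h dvd word_poly n v" using v by (simp add: Ch_iff)
    with h have "h dvd word_poly (2 * n) d" unfolding fold by simp
    moreover have "pderiv (word_poly (2 * n) d) = 0"
    proof (rule poly_eqI)
      fix i
      show "coeff (pderiv (word_poly (2 * n) d)) i = coeff 0 i"
        using even0[of "Suc i"] by (cases "even (Suc i)") (auto simp: coeff_pderiv coeff_word_poly d_def
              simp del: of_nat_Suc)
    qed
    ultimately have "h * h dvd word_poly (2 * n) d"
      by (rule square_dvd_of_pderiv_eq_0[OF h ofn])
    with g have "g * h dvd word_poly (2 * n) d"
      by (meson dvd_trans dvd_refl mult_dvd_mono)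
    with dw have "d \<in> D" by (simp add: D_iff)
    let ?e = "\<lambda>i. if even i then i else i + n"
    have supp: "{i. d i \<noteq> 0} = ?e ` {i. v i \<noteq> 0}"
    proof (intro equalityI subsetI)
      fix i assume "i \<in> {i. d i \<noteq> 0}"
      then have i: "even i" "i < 2 * n" "v (i mod n) \<noteq> 0" by (auto simp: d_def split: if_splits)
      have "i = ?e (i mod n)"
        using i(1,2) n by (cases "i < n") (auto simp: mod_if)
      with i(3) show "i \<in> ?e ` {i. v i \<noteq> 0}" by blast
    next
      fix i assume "i \<in> ?e ` {i. v i \<noteq> 0}"
      then obtain j where j: "v j \<noteq> 0" "i = ?e j" by blast
      with vw have "j < n" by (auto simp: words_def not_le[symmetric])
      with j n show "i \<in> {i. d i \<noteq> 0}" by (auto simp: d_def)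
    qed
    have "weight d \<le> weight v"
      unfolding weight_def supp by (rule card_image_le[OF finite_support_words[OF vw]])
    moreover have "d \<noteq> 0"
    proof
      assume "d = 0"
      then have "?e ` {i. v i \<noteq> 0} = {}" unfolding supp[symmetric] by simp
      with v(2) show False by (auto simp: fun_eq_iff)
    qed
    with \<open>d \<in> D\<close> have "min_dist (2 * n) D \<le> weight d" by (intro min_dist_le sub wds)
    ultimately show ?thesis by (simp add: v)
  qed
  \<comment> \<open>The lower bound was shown for the weights of nonzero words; it passes to
    \<open>min_dist\<close> because a nonzero code attains its minimum.\<close>
  moreover have "D \<noteq> {0}"
  proof -
    have "degree (g * h) < 2 * n"
      using degree_mult_le[of g h] dvd_imp_degree_le[OF g] nontriv h cyc_modulus_nonzero[OF n0]
      by (cases "h = 0") auto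
    then show ?thesis unfolding D_def by (rule code_generated_by_nontrivial[OF N0 gh])
  qed
  then obtain c where "c \<in> D" "c \<noteq> 0" "min_dist (2 * n) D = weight c"
    using min_dist_attained[OF sub(3) wds(3)] by blast
  ultimately show ?thesis
    unfolding Cg_def[symmetric] Ch_def[symmetric] D_def[symmetric]
    by (metis antisym min.boundedI)
qed

section \<open>Hermitian duals and conjugation\<close>

lemma map_poly_reflect_poly:
  assumes "field_embedding f"
  shows "map_poly f (reflect_poly p) = reflect_poly (map_poly f p)"
  by (simp add: poly_eq_iff coeff_map_poly_embedding[OF assms] coeff_reflect_poly
      degree_map_poly_embedding[OF assms] field_embedding_0[OF assms])

text \<open>The unit \<open>u\<close> is free so that \<open>g'\<close> can be taken monic. With
  \<open>T\<close> the conjugate reciprocal and \<open>g' * h' = x^n - 1\<close>,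
  \<open>T g'\<close> is a unit times \<open>h\<close>; cancelling \<open>h\<close> in
  \<open>T g' * T h' = - (g * h)\<close> makes \<open>T h'\<close> a unit times \<open>g\<close>. So
  \<open>T (h * h')\<close>, which generates the dual, is a unit times
  \<open>g * g'\<close>.\<close>

lemma hermitian_self_dual_repeated_root:
  fixes g h :: "'a::field poly"
  assumes n: "n > 0" and two: "(2 :: 'a) = 0" and gh: "g * h = cyc_modulus n"
    and frob: "field_embedding (\<lambda>z::'a. z ^ r)" and invol: "\<And>z::'a. (z ^ r) ^ r = z"
    and u: "u \<noteq> 0" and g': "g' = smult u (reflect_poly (map_poly (\<lambda>z. z ^ r) h))"
  shows "g' dvd cyc_modulus n" and "g * g' dvd cyc_modulus (2 * n)"
    and "hermitian_self_dual r (2 * n) (code_generated_by (2 * n) (g * g'))"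
proof -
  let ?F = "\<lambda>z::'a. z ^ r"
  define T where "T p = reflect_poly (map_poly ?F p)" for p :: "'a poly"
  have T_mult: "T (p * p') = T p * T p'" for p p'
    by (simp add: T_def map_poly_embedding_mult[OF frob] reflect_poly_mult)
  have T_smult: "T (smult a p) = smult (?F a) (T p)" for a p
    by (simp add: T_def map_poly_smult field_embedding_0[OF frob] field_embedding_mult[OF frob]
        reflect_poly_smult)
  have T_modulus: "T (cyc_modulus n) = - cyc_modulus n"
    by (simp add: T_def map_poly_cyc_modulus[OF frob] reflect_poly_cyc_modulus[OF n])
  have h: "h dvd cyc_modulus n" by (simp flip: gh)
  have h0: "h \<noteq> 0" using h cyc_modulus_nonzero[OF n] by auto
  have "T g * T h = - cyc_modulus n" by (simp add: gh T_modulus flip: T_mult)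
  then have "T h dvd cyc_modulus n" by (metis dvd_minus_iff dvd_triv_right)
  with u show g'M: "g' dvd cyc_modulus n" by (simp add: g' smult_dvd_iff flip: T_def)
  then obtain h' where h': "g' * h' = cyc_modulus n" by (metis dvdE)
  have "g dvd cyc_modulus n" by (simp flip: gh)
  with g'M show gg': "g * g' dvd cyc_modulus (2 * n)"
    by (simp add: cyc_modulus_double[OF two] mult_dvd_mono)
  have "map_poly ?F (map_poly ?F h) = h"
    by (simp add: poly_eq_iff coeff_map_poly_embedding[OF frob] invol)
  then have "T (T h) = h"
    using coeff_0_dvd_cyc_modulus[OF n h] by (simp add: T_def map_poly_reflect_poly[OF frob])
  then have "T g' = smult (?F u) h" by (simp add: g' T_smult flip: T_def)
  moreover have "T g' * T h' = - cyc_modulus n"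
    by (simp only: h' T_modulus flip: T_mult)
  ultimately have "smult (?F u) h * T h' = - cyc_modulus n" by simp
  then have "h * smult (?F u) (T h') = h * (- g)"
    by (simp add: gh mult.commute)
  then have "smult (?F u) (T h') = - g" using h0 by (metis mult_left_cancel)
  then have "T h' = smult (inverse (?F u)) (- g)"
    using u by (metis power_not_zero left_inverse smult_smult smult_1_left)
  then have Th': "T h' = smult (- inverse (?F u)) g" by simp
  have "g * g' * (h * h') = (g * h) * (g' * h')" by (simp only: mult_ac)
  also have "\<dots> = cyc_modulus (2 * n)" by (simp only: gh h' cyc_modulus_double[OF two])
  finally have "g * g' * (h * h') = cyc_modulus (2 * n)" .
  from hermitian_dual_code[OF _ this frob invol] n
  have "hermitian_dual r (2 * n) (code_generated_by (2 * n) (g * g')) =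
      code_generated_by (2 * n) (T h * T h')"
    by (simp flip: T_mult) (simp add: T_def)
  also have "T h * T h' = smult (- inverse (?F u) * inverse u) (g * g')"
  proof -
    have "T h = smult (inverse u) g'" using u by (simp add: g' flip: T_def)
    then have "T h * T h' = smult (inverse u) g' * smult (- inverse (?F u)) g"
      by (simp only: Th')
    also have "\<dots> = smult (- inverse (?F u) * inverse u) (g' * g)"
      by (simp only: mult_smult_left mult_smult_right smult_smult)
    finally show ?thesis by (simp only: mult.commute)
  qed
  also have "code_generated_by (2 * n) \<dots> = code_generated_by (2 * n) (g * g')"
    using n u gg' by (intro code_generated_by_smult) auto
  finally show "hermitian_self_dual r (2 * n) (code_generated_by (2 * n) (g * g'))"
    by (simp add: hermitian_self_dual_def)
qed

section \<open>Invariance of the minimum distance under conjugation\<close>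

lemma min_dist_map:
  assumes "inj f"
  shows "min_dist n ((\<lambda>c i. f (c i)) ` C) = min_dist n C"
proof -
  have hd: "hamming_dist n (\<lambda>i. f (x i)) (\<lambda>i. f (y i)) = hamming_dist n x y" for x y
    using assms by (simp add: hamming_dist_def inj_eq)
  have ne: "(\<lambda>i. f (x i)) = (\<lambda>i. f (y i)) \<longleftrightarrow> x = y" for x y :: "nat \<Rightarrow> 'a"
    using assms by (auto simp: fun_eq_iff inj_eq)
  have "{hamming_dist n x y | x y. x \<in> (\<lambda>c i. f (c i)) ` C \<and> y \<in> (\<lambda>c i. f (c i)) ` C \<and> x \<noteq> y} =
      {hamming_dist n x y | x y. x \<in> C \<and> y \<in> C \<and> x \<noteq> y}" (is "?L = ?R")
  proof (intro equalityI subsetI)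
    fix k assume "k \<in> ?L"
    then obtain x y where "k = hamming_dist n (\<lambda>i. f (x i)) (\<lambda>i. f (y i))" "x \<in> C" "y \<in> C"
      "(\<lambda>i. f (x i)) \<noteq> (\<lambda>i. f (y i))" by blast
    then show "k \<in> ?R" unfolding hd ne by blast
  next
    fix k assume "k \<in> ?R"
    then obtain x y where "k = hamming_dist n x y" "x \<in> C" "y \<in> C" "x \<noteq> y" by blast
    then have "k = hamming_dist n (\<lambda>i. f (x i)) (\<lambda>i. f (y i))"
      "(\<lambda>i. f (x i)) \<noteq> (\<lambda>i. f (y i))" "x \<in> C" "y \<in> C" by (simp_all add: hd ne)
    then show "k \<in> ?L" by blast
  qed
  then show ?thesis by (simp add: min_dist_def)
qed

text \<open>Conjugating the left argument of the Hermitian product conjugates the Euclidean one, so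
  coordinatewise conjugation maps the Euclidean dual onto the Hermitian dual; being injective, it
  preserves Hamming distances.\<close>

lemma min_dist_hermitian_dual:
  fixes C :: "(nat \<Rightarrow> 'a::field) set"
  assumes frob: "field_embedding (\<lambda>z::'a. z ^ r)" and invol: "\<And>z::'a. (z ^ r) ^ r = z"
  shows "min_dist n (hermitian_dual r n C) = min_dist n (euclidean_dual n C)"
proof -
  let ?F = "\<lambda>z::'a. z ^ r"
  have prod: "hermitian_prod r n (\<lambda>i. ?F (c i)) y = ?F (\<Sum>i<n. c i * y i)" for c y
    by (simp add: hermitian_prod_def field_embedding_sum[OF frob] power_mult_distrib)
  have words: "(\<lambda>i. ?F (c i)) \<in> words n" if "c \<in> words n" for c
    using that field_embedding_0[OF frob] by (simp add: words_def)
  have "hermitian_dual r n C = (\<lambda>c i. ?F (c i)) ` euclidean_dual n C"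
  proof (intro equalityI subsetI)
    fix c assume "c \<in> hermitian_dual r n C"
    then have c: "c \<in> words n" "\<And>y. y \<in> C \<Longrightarrow> hermitian_prod r n c y = 0"
      by (auto simp: hermitian_dual_def)
    have "(\<lambda>i. ?F (c i)) \<in> euclidean_dual n C"
      using words[OF c(1)] c(2) prod[of "\<lambda>i. ?F (c i)"]
      by (simp add: euclidean_dual_def invol field_embedding_eq_0_iff[OF frob])
    then show "c \<in> (\<lambda>c i. ?F (c i)) ` euclidean_dual n C"
      by (rule rev_image_eqI) (simp add: invol)
  next
    fix c assume "c \<in> (\<lambda>c i. ?F (c i)) ` euclidean_dual n C"
    then obtain c' where "c = (\<lambda>i. ?F (c' i))" "c' \<in> euclidean_dual n C" by blast
    then show "c \<in> hermitian_dual r n C"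
      using words[of c'] prod[of c'] field_embedding_0[OF frob]
      by (simp add: hermitian_dual_def euclidean_dual_def)
  qed
  then show ?thesis by (simp only: min_dist_map[OF field_embedding_inj[OF frob]])
qed


section \<open>Finite fields of characteristic two\<close>

text \<open>Multiplication by a nonzero \<open>x\<close> permutes the nonzero elements; comparing
  their products makes \<open>x\<close> to the number of nonzero elements equal to
  \<open>1\<close>.\<close>

lemma finite_field_power_card:
  fixes x :: "'a::{field,finite}"
  shows "x ^ CARD('a) = x"
proof (cases "x = 0")
  case False
  have "(\<Prod>y\<in>UNIV - {0}. x * y) = (\<Prod>y\<in>UNIV - {0}. y)"
    by (rule prod.reindex_bij_witness[of _ "\<lambda>y. y / x" "\<lambda>y. x * y"]) (use False in auto)
  then have "x ^ card (UNIV - {0 :: 'a}) * \<Prod>(UNIV - {0}) = \<Prod>(UNIV - {0})"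
    by (simp add: prod.distrib)
  then have "x ^ card (UNIV - {0 :: 'a}) = 1" by simp
  moreover have "CARD('a) = Suc (card (UNIV - {0 :: 'a}))"
    by (rule card_Suc_Diff1[OF finite UNIV_I, symmetric])
  ultimately show ?thesis by (simp only: power_Suc mult_1_right)
qed simp

text \<open>Evaluate the power at \<open>-1\<close>: an even exponent gives \<open>1\<close>,
  whereas raising to the field size fixes \<open>-1\<close>.\<close>

lemma finite_field_two_eq_0:
  assumes "even CARD('a::{field,finite})"
  shows "(2 :: 'a) = 0"
proof -
  have "(- 1 :: 'a) ^ CARD('a) = 1" using assms by simp
  then have "(1 :: 'a) = - 1" by (simp add: finite_field_power_card)
  then have "(1 :: 'a) + 1 = 0" by (simp only: add_eq_0_iff)
  then show ?thesis by simp
qed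

lemma field_embedding_frobenius:
  assumes "(2 :: 'a::field) = 0"
  shows "field_embedding (\<lambda>z::'a. z ^ (2 ^ k))"
proof -
  have "(x + y) ^ (2 ^ k) = x ^ (2 ^ k) + y ^ (2 ^ k)" for x y :: 'a
  proof (induction k)
    case (Suc k)
    have "(x + y) ^ (2 ^ Suc k) = (x ^ (2 ^ k) + y ^ (2 ^ k))\<^sup>2"
      by (simp add: mult.commute[of 2] power_mult Suc)
    also have "\<dots> = (x ^ (2 ^ k))\<^sup>2 + (y ^ (2 ^ k))\<^sup>2"
      using assms by (simp add: power2_sum)
    also have "\<dots> = x ^ (2 ^ Suc k) + y ^ (2 ^ Suc k)"
      by (simp add: mult.commute[of 2] power_mult)
    finally show ?case .
  qed simp
  then show ?thesis by (simp add: field_embedding_def power_mult_distrib)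
qed

text \<open>The image already supplies as many roots of \<open>x^q - x\<close> as its degree
  \<open>q\<close> allows. It serves as a descent criterion: coefficients fixed by the
  \<open>q\<close>-th power come from the small field.\<close>

lemma range_field_embedding:
  fixes \<iota> :: "'a::{field,finite} \<Rightarrow> 'b::field"
  assumes \<iota>: "field_embedding \<iota>"
  shows "range \<iota> = {z. z ^ CARD('a) = z}"
proof (rule card_seteq)
  let ?q = "CARD('a)"
  have "card {0, 1 :: 'a} \<le> ?q" by (rule card_mono) auto
  then have q: "?q > 1" by simp
  define P where "P = (monom 1 ?q - monom 1 1 :: 'b poly)"
  have "coeff P ?q = 1" using q by (simp add: P_def)
  then have P0: "P \<noteq> 0" by auto
  have roots: "{z. z ^ ?q = z} = {z. poly P z = 0}"
    by (simp add: P_def poly_monom)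
  show "finite {z :: 'b. z ^ ?q = z}"
    unfolding roots by (rule poly_roots_finite[OF P0])
  have "degree P \<le> ?q"
    by (rule degree_le) (use q in \<open>auto simp: P_def\<close>)
  moreover have "card {z. poly P z = 0} \<le> degree P"
    by (rule card_poly_roots_bound[OF P0])
  ultimately show "card {z :: 'b. z ^ ?q = z} \<le> card (range \<iota>)"
    unfolding roots by (simp add: card_image[OF field_embedding_inj[OF \<iota>]])
  show "range \<iota> \<subseteq> {z. z ^ ?q = z}"
    by (auto simp: finite_field_power_card simp flip: field_embedding_power[OF \<iota>])
qed


section \<open>The generator of a BCH code\<close>

text \<open>Division with remainder by a nonzero element of least degree. Applied to the polynomials
  vanishing at a point and to the common multiples of a set, it turns both definite descriptions,
  \<open>min_poly\<close> and \<open>monic_lcm\<close>, into divisibility criteria.\<close>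

lemma monic_ideal_generator:
  fixes I :: "'a::field poly set"
  assumes diff: "\<And>p p'. p \<in> I \<Longrightarrow> p' \<in> I \<Longrightarrow> p - p' \<in> I"
    and mult: "\<And>p k. p \<in> I \<Longrightarrow> k * p \<in> I"
    and nonzero: "p \<in> I" "p \<noteq> 0"
  obtains g where "lead_coeff g = 1" "\<And>f. f \<in> I \<longleftrightarrow> g dvd f"
proof -
  obtain p where p: "p \<in> I \<and> p \<noteq> 0" and min: "\<And>f. f \<in> I \<and> f \<noteq> 0 \<Longrightarrow> degree p \<le> degree f"
    using ex_has_least_nat[of "\<lambda>p. p \<in> I \<and> p \<noteq> 0" _ degree] nonzero by blast
  define g where "g = smult (inverse (lead_coeff p)) p"
  have dvd_iff: "g dvd f \<longleftrightarrow> p dvd f" for f using p by (simp add: g_def smult_dvd_iff)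
  show ?thesis
  proof (rule that)
    show "lead_coeff g = 1" using p by (simp add: g_def)
    show "f \<in> I \<longleftrightarrow> g dvd f" for f
    proof
      assume "f \<in> I"
      then have "f mod p \<in> I"
        using diff[OF \<open>f \<in> I\<close> mult[of p "f div p"]] p by (simp add: minus_div_mult_eq_mod)
      then have "f mod p = 0"
        using min[of "f mod p"] p degree_mod_less[of p f] by force
      then show "g dvd f" by (simp add: dvd_iff mod_eq_0_iff_dvd)
    next
      assume "g dvd f"
      then obtain k where "f = p * k" unfolding dvd_iff by blast
      then show "f \<in> I" using mult[of p k] p by (simp add: mult.commute)
    qed
  qed
qed

lemma min_poly_props:
  assumes \<iota>: "field_embedding \<iota>" and f0: "f0 \<noteq> 0" "poly (map_poly \<iota> f0) b = 0"
  shows "lead_coeff (min_poly \<iota> b) = 1"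
    and "min_poly \<iota> b dvd f \<longleftrightarrow> poly (map_poly \<iota> f) b = 0"
proof -
  obtain g where g: "lead_coeff g = 1"
    "\<And>f. f \<in> {f. poly (map_poly \<iota> f) b = 0} \<longleftrightarrow> g dvd f"
    by (rule monic_ideal_generator[of "{f. poly (map_poly \<iota> f) b = 0}" f0])
       (use f0 in \<open>simp_all add: map_poly_embedding_diff[OF \<iota>] map_poly_embedding_mult[OF \<iota>]\<close>)
  have "min_poly \<iota> b = g"
    unfolding min_poly_def
  proof (rule the_equality, intro conjI allI impI)
    show "poly (map_poly \<iota> g) b = 0" using g(2)[of g] by simp
    show "degree g \<le> degree f" if "f \<noteq> 0 \<and> poly (map_poly \<iota> f) b = 0" for f
      using g(2)[of f] that by (auto intro: dvd_imp_degree_le)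
    fix p assume p: "lead_coeff p = 1 \<and> poly (map_poly \<iota> p) b = 0 \<and>
      (\<forall>f. f \<noteq> 0 \<and> poly (map_poly \<iota> f) b = 0 \<longrightarrow> degree p \<le> degree f)"
    then have "g dvd p" using g(2)[of p] by simp
    moreover have "p \<noteq> 0" using p by auto
    moreover have "g \<noteq> 0" using g(1) by auto
    then have "degree p \<le> degree g" using p \<open>poly (map_poly \<iota> g) b = 0\<close> by blast
    ultimately have "p dvd g" by (rule dvd_poly_degree_ge_imp_dvd)
    with \<open>g dvd p\<close> show "p = g" using p g(1) by (intro monic_dvd_antisym) auto
  qed (rule g(1))
  with g show "lead_coeff (min_poly \<iota> b) = 1"
    and "min_poly \<iota> b dvd f \<longleftrightarrow> poly (map_poly \<iota> f) b = 0" by auto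
qed

lemma monic_lcm_props:
  fixes S :: "'a::field poly set"
  assumes M: "M \<noteq> 0" "\<And>f. f \<in> S \<Longrightarrow> f dvd M"
  shows "lead_coeff (monic_lcm S) = 1" and "monic_lcm S dvd h \<longleftrightarrow> (\<forall>f\<in>S. f dvd h)"
proof -
  obtain g where g: "lead_coeff g = 1" "\<And>h. h \<in> {h. \<forall>f\<in>S. f dvd h} \<longleftrightarrow> g dvd h"
    by (rule monic_ideal_generator[of "{h. \<forall>f\<in>S. f dvd h}" M]) (use M in auto)
  have "monic_lcm S = g"
    unfolding monic_lcm_def
  proof (rule the_equality)
    show "lead_coeff g = 1 \<and> (\<forall>f\<in>S. f dvd g) \<and> (\<forall>h. (\<forall>f\<in>S. f dvd h) \<longrightarrow> g dvd h)"
      using g g(2)[of g] by auto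
    fix p assume p: "lead_coeff p = 1 \<and> (\<forall>f\<in>S. f dvd p) \<and> (\<forall>h. (\<forall>f\<in>S. f dvd h) \<longrightarrow> p dvd h)"
    have "p dvd g" using p g(2)[of g] by simp
    moreover have "g dvd p" using p g(2)[of p] by simp
    ultimately show "p = g" using p g(1) by (intro monic_dvd_antisym) auto
  qed
  with g show "lead_coeff (monic_lcm S) = 1"
    and "monic_lcm S dvd h \<longleftrightarrow> (\<forall>f\<in>S. f dvd h)" by auto
qed

text \<open>The polynomial \<open>x^n - 1\<close> vanishes at every power of \<open>\<beta>\<close>;
  it is the nonzero witness that makes the minimal polynomials and their common multiple well
  defined.\<close>

lemma bch_generator:
  fixes \<iota> :: "'a::field \<Rightarrow> 'b::field" and A :: "int set"
  assumes \<iota>: "field_embedding \<iota>" and n: "n > 0" and \<beta>: "\<beta> ^ n = 1"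
  defines "g \<equiv> monic_lcm ((\<lambda>i. min_poly \<iota> (\<beta> powi i)) ` A)"
  shows "lead_coeff g = 1" and "g dvd cyc_modulus n"
    and "g dvd h \<longleftrightarrow> (\<forall>i\<in>A. poly (map_poly \<iota> h) (\<beta> powi i) = 0)"
proof -
  have root: "poly (map_poly \<iota> (cyc_modulus n)) (\<beta> powi i) = 0" for i
  proof -
    have "(\<beta> powi i) ^ n = (\<beta> ^ n) powi i"
      by (simp add: mult.commute flip: power_int_mult power_int_of_nat)
    then show ?thesis by (simp add: map_poly_cyc_modulus[OF \<iota>] poly_cyc_modulus \<beta>)
  qed
  note mp = min_poly_props[OF \<iota> cyc_modulus_nonzero[OF n] root]
  have *: "f dvd cyc_modulus n" if "f \<in> (\<lambda>i. min_poly \<iota> (\<beta> powi i)) ` A" for f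
    using that mp(2) root by auto
  note lp = monic_lcm_props[OF cyc_modulus_nonzero[OF n] *]
  show "lead_coeff g = 1" unfolding g_def by (rule lp(1))
  show iff: "g dvd h \<longleftrightarrow> (\<forall>i\<in>A. poly (map_poly \<iota> h) (\<beta> powi i) = 0)" for h
    unfolding g_def using lp(2) by (simp add: mp(2))
  show "g dvd cyc_modulus n" by (simp add: iff root)
qed

section \<open>Powers of a primitive root of unity and the BCH bound\<close>

lemma primitive_root_power_eq_1_iff:
  assumes "primitive_root_of_unity n \<beta>"
  shows "\<beta> ^ k = 1 \<longleftrightarrow> n dvd k"
proof
  assume "\<beta> ^ k = 1"
  moreover have n: "n > 0" "\<beta> ^ n = 1" and min: "\<And>k. 0 < k \<Longrightarrow> k < n \<Longrightarrow> \<beta> ^ k \<noteq> 1"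
    using assms by (auto simp: primitive_root_of_unity_def)
  have "\<beta> ^ k = \<beta> ^ (n * (k div n) + k mod n)" by simp
  also have "\<dots> = \<beta> ^ (k mod n)" by (simp only: power_add power_mult n power_one mult_1_left)
  ultimately have "k mod n = 0" using min[of "k mod n"] n by auto
  then show "n dvd k" by (simp add: mod_eq_0_iff_dvd)
qed (use assms in \<open>auto simp: primitive_root_of_unity_def power_mult\<close>)

lemma primitive_root_inj_on:
  assumes "primitive_root_of_unity n \<beta>"
  shows "inj_on (\<lambda>i. \<beta> ^ i) {..<n}"
proof -
  have n: "\<beta> \<noteq> 0" using assms by (auto simp: primitive_root_of_unity_def power_0_left)
  have "i = j" if "\<beta> ^ i = \<beta> ^ j" "i \<le> j" "j < n" for i j
  proof -
    have "\<beta> ^ i * \<beta> ^ (j - i) = \<beta> ^ i * 1"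
      using that by (metis le_add_diff_inverse mult_1_right power_add)
    then have "\<beta> ^ (j - i) = 1" using n by simp
    then have "n dvd j - i" by (simp only: primitive_root_power_eq_1_iff[OF assms])
    then show "i = j" using that dvd_imp_le[of n "j - i"] by (cases "j - i = 0") auto
  qed
  note eq = this
  show ?thesis
  proof (rule inj_onI)
    fix i j assume "i \<in> {..<n}" "j \<in> {..<n}" "\<beta> ^ i = \<beta> ^ j"
    then show "i = j" using eq[of i j] eq[of j i] by (cases "i \<le> j") auto
  qed
qed

text \<open>
  A polynomial vanishing at all but one of the locators of \<open>c\<close> would have degree less than
  \<open>k\<close> if the weight were at most \<open>k\<close>; pairing it with \<open>c\<close> isolates one coordinate.
\<close>

lemma bch_bound:
  fixes \<iota> :: "'a::field \<Rightarrow> 'b::field"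
  assumes \<iota>: "field_embedding \<iota>" and \<beta>: "primitive_root_of_unity n \<beta>"
    and c: "c \<in> words n" "c \<noteq> 0"
    and zeros: "\<And>j. 1 \<le> j \<Longrightarrow> j \<le> k \<Longrightarrow> poly (map_poly \<iota> (word_poly n c)) (\<beta> ^ j) = 0"
  shows "k < weight c"
proof (rule ccontr)
  assume "\<not> k < weight c"
  define S where "S = {i. c i \<noteq> 0}"
  have S: "finite S" "S \<subseteq> {..<n}" and wS: "card S \<le> k"
    using c(1) finite_support_words[OF c(1)] \<open>\<not> k < weight c\<close>
    by (auto simp: S_def weight_def words_def not_le[symmetric])
  have \<beta>0: "\<beta> \<noteq> 0" using \<beta> by (auto simp: primitive_root_of_unity_def power_0_left)
  have n: "n > 0" using \<beta> by (simp add: primitive_root_of_unity_def)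
  have ev: "(\<Sum>i\<in>S. \<iota> (c i) * (\<beta> ^ i) ^ j) = 0" if "1 \<le> j" "j \<le> k" for j
  proof -
    have "poly (map_poly \<iota> (word_poly n c)) (\<beta> ^ j) = (\<Sum>i<n. \<iota> (c i) * (\<beta> ^ j) ^ i)"
    proof -
      have "map_poly \<iota> (word_poly n c) = (\<Sum>i<n. monom (\<iota> (c i)) i)"
        by (simp add: poly_eq_iff coeff_map_poly_embedding[OF \<iota>] coeff_word_poly coeff_sum
            field_embedding_0[OF \<iota>])
      then show ?thesis by (simp add: poly_sum poly_monom)
    qed
    also have "\<dots> = (\<Sum>i\<in>S. \<iota> (c i) * (\<beta> ^ j) ^ i)"
      using S by (intro sum.mono_neutral_right) (auto simp: S_def field_embedding_0[OF \<iota>])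
    also have "\<dots> = (\<Sum>i\<in>S. \<iota> (c i) * (\<beta> ^ i) ^ j)"
      by (simp add: mult.commute flip: power_mult)
    finally show ?thesis using zeros[OF that] by simp
  qed
  \<comment> \<open>The prescribed zeros start at exponent \<open>1\<close>, not \<open>0\<close>.
    The extra factor \<open>\<beta> ^ i\<close> moves coefficient \<open>j\<close> of
    \<open>f\<close> to exponent \<open>Suc j\<close>, which lies between \<open>1\<close> and
    \<open>k\<close>.\<close>
  have pairing: "(\<Sum>i\<in>S. \<iota> (c i) * \<beta> ^ i * poly f (\<beta> ^ i)) = 0" if f: "degree f < k" for f
  proof -
    have "(\<Sum>i\<in>S. \<iota> (c i) * \<beta> ^ i * poly f (\<beta> ^ i)) =
        (\<Sum>i\<in>S. \<Sum>j\<le>degree f. coeff f j * (\<iota> (c i) * (\<beta> ^ i) ^ Suc j))"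
      by (simp add: poly_altdef sum_distrib_left mult_ac)
    also have "\<dots> = (\<Sum>j\<le>degree f. coeff f j * (\<Sum>i\<in>S. \<iota> (c i) * (\<beta> ^ i) ^ Suc j))"
      unfolding sum_distrib_left by (rule sum.swap)
    also have "\<dots> = 0"
      using f by (intro sum.neutral ballI) (simp add: ev del: power_Suc)
    finally show ?thesis .
  qed
  obtain i0 where i0: "i0 \<in> S" using c(2) by (auto simp: S_def fun_eq_iff)
  define f where "f = (\<Prod>i\<in>S - {i0}. [:- (\<beta> ^ i), 1:])"
  have "degree f = card S - 1"
    using S i0 by (simp add: f_def degree_prod_eq_sum_degree)
  moreover have "card S > 0" using S i0 by (auto simp: card_gt_0_iff)
  ultimately have "degree f < k" using wS by simp
  then have "0 = (\<Sum>i\<in>S. \<iota> (c i) * \<beta> ^ i * poly f (\<beta> ^ i))" by (simp add: pairing)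
  also have "\<dots> = (\<Sum>i\<in>{i0}. \<iota> (c i) * \<beta> ^ i * poly f (\<beta> ^ i))"
    using S i0 by (intro sum.mono_neutral_right) (auto simp: f_def poly_prod)
  finally have "poly f (\<beta> ^ i0) = 0"
    using i0 \<beta>0 by (simp add: S_def field_embedding_eq_0_iff[OF \<iota>])
  then obtain i where "i \<in> S - {i0}" "\<beta> ^ i0 = \<beta> ^ i"
    using S by (auto simp: f_def poly_prod)
  moreover from this have "i0 = i"
    using S(2) i0 by (intro inj_onD[OF primitive_root_inj_on[OF \<beta>]]) auto
  ultimately show False by simp
qed

text \<open>
  The product over a Frobenius-stable set of roots has coefficients in the small field, so the
  generator divides it.
\<close>

lemma bch_generator_roots:
  fixes \<iota> :: "'a::{field,finite} \<Rightarrow> 'b::{field,finite}"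
  assumes \<iota>: "field_embedding \<iota>" and frob: "field_embedding (\<lambda>z::'b. z ^ CARD('a))"
    and stable: "\<And>z. z \<in> R \<Longrightarrow> z ^ CARD('a) \<in> R"
    and g: "\<And>h. (\<forall>z\<in>R. poly (map_poly \<iota> h) z = 0) \<Longrightarrow> g dvd h"
    and y: "poly (map_poly \<iota> g) y = 0"
  shows "y \<in> R"
proof -
  let ?F = "\<lambda>z::'b. z ^ CARD('a)"
  define Q where "Q = (\<Prod>z\<in>R. [:- z, (1 :: 'b):])"
  have inj: "inj_on ?F R" using field_embedding_inj[OF frob] by (rule inj_on_subset) simp
  have img: "?F ` R = R" using stable inj by (intro endo_inj_surj) auto
  have "map_poly ?F Q = (\<Prod>z\<in>R. [:- (z ^ CARD('a)), 1:])"
    by (simp add: Q_def map_poly_embedding_prod[OF frob] map_poly_pCons field_embedding_0[OF frob]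
        field_embedding_uminus[OF frob] field_embedding_1[OF frob])
  also have "\<dots> = (\<Prod>z\<in>?F ` R. [:- z, (1 :: 'b):])" by (simp add: prod.reindex[OF inj])
  also have "\<dots> = Q" by (simp add: img Q_def)
  finally have "coeff Q i ^ CARD('a) = coeff Q i" for i
    by (metis coeff_map_poly_embedding[OF frob])
  then have rng: "coeff Q i \<in> range \<iota>" for i
    by (simp add: range_field_embedding[OF \<iota>])
  define Q0 where "Q0 = map_poly (inv_into UNIV \<iota>) Q"
  have "inv_into UNIV \<iota> 0 = 0"
    using field_embedding_inj[OF \<iota>] field_embedding_0[OF \<iota>] by (metis inv_f_f)
  then have Q: "map_poly \<iota> Q0 = Q"
    by (simp add: poly_eq_iff Q0_def coeff_map_poly_embedding[OF \<iota>] coeff_map_poly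
        f_inv_into_f[OF rng])
  have "g dvd Q0"
    by (rule g) (auto simp: Q Q_def poly_prod)
  from map_poly_embedding_dvd[OF \<iota> this] y have "poly Q y = 0"
    by (auto simp: Q)
  then show ?thesis by (auto simp: Q_def poly_prod)
qed

section \<open>Hermitian dual containment of the BCH code\<close>

text \<open>The worst case is \<open>a = m - 1\<close> with \<open>i\<close> and \<open>j\<close>
  maximal: \<open>r^2 (r^(m-1) - 1)(1 + r^(m-1)) = r^(2m) - r^2\<close>, and \<open>r^2 > 1\<close>.
  The proof writes \<open>R\<close> for \<open>r^(m-1) - 1\<close> to avoid truncated
  subtraction.\<close>

lemma hermitian_coset_sum_less:
  fixes r m a i j :: nat
  assumes r: "r \<ge> 2" and a: "a < m"
    and i: "i \<le> r ^ (m + 1) - r ^ 2" and j: "j \<le> r ^ (m + 1) - r ^ 2"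
  shows "i + j * r ^ a < r ^ (2 * m) - 1"
proof -
  obtain p where m: "m = Suc p" using a by (cases m) auto
  obtain R where R: "r ^ p = Suc R" using r by (metis not0_implies_Suc not_numeral_le_zero power_not_zero)
  have "r ^ (m + 1) - r ^ 2 = r ^ 2 * R"
    using R by (simp add: m power2_eq_square diff_mult_distrib2 add_mult_distrib2 mult_ac)
  with i j have i': "i \<le> r ^ 2 * R" and j': "j \<le> r ^ 2 * R" by simp_all
  have "r ^ a \<le> Suc R"
    unfolding R[symmetric] using a r by (intro power_increasing) (auto simp: m)
  then have "i + j * r ^ a \<le> r ^ 2 * R + r ^ 2 * R * Suc R"
    using i' j' by (intro add_mono mult_mono) auto
  moreover have "r ^ (2 * m) = r ^ 2 * R + r ^ 2 * R * Suc R + r ^ 2"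
  proof -
    have "2 * m = 2 + (p + p)" by (simp add: m)
    then have "r ^ (2 * m) = r ^ 2 * (r ^ p * r ^ p)" by (simp only: power_add)
    then show ?thesis by (simp add: R algebra_simps)
  qed
  moreover have "r ^ 2 > 1" using r by (intro one_less_power) auto
  ultimately show ?thesis by linarith
qed

text \<open>
  Scaling by a power of \<open>r\<close> reduces both exponents modulo \<open>2 * m\<close> to one odd exponent \<open>a\<close>;
  as \<open>m\<close> is even, either \<open>a < m\<close> or \<open>2 * m - a < m\<close>, and then the sum is too small to be
  divisible by \<open>n\<close>.
\<close>

lemma hermitian_coset_disjoint:
  fixes r m l i j n :: nat
  assumes r: "r \<ge> 2" and m: "even m" "m > 0" and n: "n = r ^ (2 * m) - 1"
    and i: "1 \<le> i" "i \<le> r ^ (m + 1) - r ^ 2" and j: "1 \<le> j" "j \<le> r ^ (m + 1) - r ^ 2"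
  shows "\<not> n dvd i * r ^ (2 * l) + j * r ^ (2 * m - 1)"
proof
  assume dvd: "n dvd i * r ^ (2 * l) + j * r ^ (2 * m - 1)"
  have rn: "r ^ (2 * m) = Suc n" using r n by simp
  have reduce: "n dvd x + y" if "n dvd x * r ^ (2 * m * t) + y * r ^ (2 * m * u)" for x y t u
  proof -
    have "\<exists>c. r ^ (2 * m * t) = Suc (n * c)" for t
    proof (induction t)
      case (Suc t)
      then obtain c where "r ^ (2 * m * t) = Suc (n * c)" by blast
      then have "r ^ (2 * m * Suc t) = Suc n * Suc (n * c)" by (simp add: power_add rn)
      also have "\<dots> = Suc (n * (c + 1 + n * c))" by (simp add: algebra_simps)
      finally show ?case by blast
    qed (auto intro: exI[of _ 0])
    then obtain c d where "r ^ (2 * m * t) = Suc (n * c)" "r ^ (2 * m * u) = Suc (n * d)" by metis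
    with that have "n dvd n * (x * c + y * d) + (x + y)" by (simp add: algebra_simps)
    then show ?thesis by (simp add: dvd_add_right_iff)
  qed
  have small: False if "n dvd x + y * r ^ a" "a < m" "1 \<le> x" "x \<le> r ^ (m + 1) - r ^ 2"
    "y \<le> r ^ (m + 1) - r ^ 2" for x y a
    using hermitian_coset_sum_less[OF r that(2,4,5)] dvd_imp_le[OF that(1)] that(3) n by simp
  \<comment> \<open>The factor \<open>r ^ (2 * m - 2 * l')\<close> completes \<open>2 * l\<close> to
    a multiple of \<open>2 * m\<close> and carries the other exponent \<open>2 * m - 1\<close> to
    \<open>a\<close> modulo \<open>2 * m\<close>. The subtractions are exact because
    \<open>l' < m\<close>.\<close>
  define t l' a where "t = l div m" and "l' = l mod m" and "a = 2 * m - 1 - 2 * l'"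
  have l': "l' < m" using m by (simp add: l'_def)
  have "l = m * t + l'" by (simp add: t_def l'_def)
  with l' have e: "2 * l + (2 * m - 2 * l') = 2 * m * (t + 1)" by (simp add: algebra_simps)
  have e': "2 * m - 1 + (2 * m - 2 * l') = a + 2 * m" using l' m by (simp add: a_def)
  from dvd have "n dvd (i * r ^ (2 * l) + j * r ^ (2 * m - 1)) * r ^ (2 * m - 2 * l')" by simp
  also have "\<dots> = i * r ^ (2 * l + (2 * m - 2 * l')) + j * r ^ (2 * m - 1 + (2 * m - 2 * l'))"
    by (simp only: power_add distrib_right mult.assoc)
  also have "\<dots> = i * r ^ (2 * m * (t + 1)) + (j * r ^ a) * r ^ (2 * m * 1)"
    unfolding e e' by (simp add: power_add)
  finally have dvd1: "n dvd i + j * r ^ a" by (rule reduce)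
  have "odd a" using l' by (simp add: a_def)
  with m(1) have "a \<noteq> m" by auto
  then consider "a < m" | "a > m" by linarith
  then show False
  proof cases
    case 1
    with small[OF dvd1] i j show False by simp
  next
    case 2
    \<comment> \<open>Multiplying by the complementary power moves the factor from \<open>j\<close>
      to \<open>i\<close>, so the bound applies with the two exponents interchanged.\<close>
    have a2: "a \<le> 2 * m" by (simp add: a_def)
    from dvd1 have "n dvd (i + j * r ^ a) * r ^ (2 * m - a)" by simp
    also have "\<dots> = (i * r ^ (2 * m - a)) * r ^ (2 * m * 0) + j * r ^ (2 * m * 1)"
      using a2 by (simp add: distrib_right mult.assoc flip: power_add)
    finally have "n dvd i * r ^ (2 * m - a) + j" by (rule reduce)
    then have "n dvd j + i * r ^ (2 * m - a)" by (simp add: add.commute)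
    moreover have "2 * m - a < m" using 2 m(2) by linarith
    ultimately show False using i j by (intro small)
  qed
qed

text \<open>The value of the conjugate reciprocal of \<open>h\<close> at \<open>\<beta> ^ j\<close>
  is governed by \<open>h\<close> at the \<open>y\<close> with
  \<open>y ^ r = inverse (\<beta> ^ j)\<close>. This \<open>y\<close> is a root of
  \<open>x^n - 1 = g * h\<close> but, by \<open>hermitian_coset_disjoint\<close>, not of
  \<open>g\<close>; hence it is a root of \<open>h\<close>.\<close>

lemma bch_generator_dvd_conj_reciprocal:
  fixes \<iota> :: "'a::{field,finite} \<Rightarrow> 'b::{field,finite}" and g h :: "'a poly"
  assumes \<iota>: "field_embedding \<iota>" and r: "r = 2 ^ s" "s \<ge> 1" and m: "even m" "m > 0"
    and card: "CARD('a) = r ^ 2" and n: "n = r ^ (2 * m) - 1"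
    and \<beta>: "primitive_root_of_unity n \<beta>"
    and gh: "g * h = cyc_modulus n"
    and g: "\<And>f. g dvd f \<longleftrightarrow>
      (\<forall>j. 1 \<le> j \<and> j \<le> r ^ (m + 1) - r ^ 2 \<longrightarrow> poly (map_poly \<iota> f) (\<beta> ^ j) = 0)"
  shows "g dvd reflect_poly (map_poly (\<lambda>z. z ^ r) h)"
proof -
  let ?k = "r ^ (m + 1) - r ^ 2"
  let ?G = "map_poly \<iota> g" and ?H = "map_poly \<iota> h"
  have "(2 :: 'a) = 0" using r by (intro finite_field_two_eq_0) (simp add: card)
  then have "\<iota> (1 + 1) = \<iota> 0" by simp
  then have two: "(2 :: 'b) = 0"
    by (simp only: field_embedding_add[OF \<iota>] field_embedding_1[OF \<iota>] field_embedding_0[OF \<iota>]) simp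
  have frob: "field_embedding (\<lambda>z::'b. z ^ r)"
    unfolding r by (rule field_embedding_frobenius[OF two])
  have frob2: "field_embedding (\<lambda>z::'b. z ^ CARD('a))"
    using field_embedding_frobenius[OF two, of "s * 2"] by (simp add: card r flip: power_mult)
  have r2: "r \<ge> 2" using r by (metis numeral_2_eq_2 one_le_numeral power_increasing power_one_right)
  have rn: "r ^ (2 * m) = Suc n" using r n by simp
  have \<beta>n: "\<beta> ^ n = 1" and \<beta>0: "\<beta> \<noteq> 0"
    using \<beta> by (auto simp: primitive_root_of_unity_def power_0_left)
  have \<beta>r: "\<beta> ^ (r ^ (2 * m)) = \<beta>" by (simp add: rn \<beta>n)
  \<comment> \<open>The exponents run through the cyclotomic cosets of \<open>1, ..., ?k\<close>, as
    \<open>r ^ 2\<close> is the size of the small field. Leaving \<open>l\<close> unbounded makes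
    stability under Frobenius immediate.\<close>
  define R where "R = {\<beta> ^ (i * r ^ (2 * l)) | i l. 1 \<le> i \<and> i \<le> ?k}"
  have roots: "y \<in> R" if "poly ?G y = 0" for y
  proof (rule bch_generator_roots[OF \<iota> frob2 _ _ that])
    fix z assume "z \<in> R"
    then obtain i l where "z = \<beta> ^ (i * r ^ (2 * l))" "1 \<le> i" "i \<le> ?k" by (auto simp: R_def)
    moreover have "(\<beta> ^ (i * r ^ (2 * l))) ^ CARD('a) = \<beta> ^ (i * r ^ (2 * Suc l))"
      by (simp add: card mult_ac power2_eq_square flip: power_mult)
    ultimately show "z ^ CARD('a) \<in> R" unfolding R_def by blast
  next
    fix f assume f: "\<forall>z\<in>R. poly (map_poly \<iota> f) z = 0"
    have "\<beta> ^ j \<in> R" if "1 \<le> j" "j \<le> ?k" for j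
    proof -
      have "\<beta> ^ j = \<beta> ^ (j * r ^ (2 * 0))" by simp
      with that show ?thesis unfolding R_def by blast
    qed
    with f show "g dvd f" unfolding g by blast
  qed
  show ?thesis
    unfolding g
  proof (intro allI impI, elim conjE)
    fix j assume j: "1 \<le> j" "j \<le> ?k"
    \<comment> \<open>Since \<open>r ^ (2 * m)\<close> is \<open>1\<close> modulo \<open>n\<close>,
      raising to the power \<open>r ^ (2 * m - 1)\<close> extracts \<open>r\<close>-th roots among
      the powers of \<open>\<beta>\<close>.\<close>
    define y where "y = inverse (\<beta> ^ (j * r ^ (2 * m - 1)))"
    have "r ^ (2 * m - 1) * r = r ^ (2 * m)"
      using m by (metis mult_pos_pos power_minus_mult zero_less_numeral)
    then have "(\<beta> ^ (j * r ^ (2 * m - 1))) ^ r = (\<beta> ^ (r ^ (2 * m))) ^ j"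
      by (simp add: mult_ac flip: power_mult)
    then have yr: "y ^ r = inverse (\<beta> ^ j)" by (simp add: y_def \<beta>r power_inverse)
    have "poly ?G y \<noteq> 0"
    proof
      assume "poly ?G y = 0"
      from roots[OF this] obtain i l where i: "1 \<le> i" "i \<le> ?k" and "y = \<beta> ^ (i * r ^ (2 * l))"
        by (auto simp: R_def)
      then have "\<beta> ^ (i * r ^ (2 * l)) * \<beta> ^ (j * r ^ (2 * m - 1)) = 1"
        using \<beta>0 by (simp add: y_def flip: \<open>y = \<beta> ^ (i * r ^ (2 * l))\<close>)
      then have "n dvd i * r ^ (2 * l) + j * r ^ (2 * m - 1)"
        by (simp add: primitive_root_power_eq_1_iff[OF \<beta>] flip: power_add)
      with hermitian_coset_disjoint[OF r2 m n i j] show False by blast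
    qed
    moreover have "poly ?G y * poly ?H y = 0"
    proof -
      have "(\<beta> ^ (j * r ^ (2 * m - 1))) ^ n = 1"
        by (metis \<beta>n mult.commute power_mult power_one)
      then have "y ^ n = 1" by (simp add: y_def power_inverse)
      have "poly ?G y * poly ?H y = poly (map_poly \<iota> (g * h)) y"
        by (simp add: map_poly_embedding_mult[OF \<iota>])
      also have "\<dots> = 0"
        by (simp add: gh map_poly_cyc_modulus[OF \<iota>] poly_cyc_modulus \<open>y ^ n = 1\<close>)
      finally show ?thesis .
    qed
    ultimately have Hy: "poly ?H y = 0" by simp
    have "map_poly \<iota> (map_poly (\<lambda>z. z ^ r) h) = map_poly (\<lambda>z. z ^ r) ?H"
      using r by (simp add: poly_eq_iff coeff_map_poly field_embedding_0[OF \<iota>]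
          field_embedding_power[OF \<iota>] power_0_left)
    then have "poly (map_poly \<iota> (reflect_poly (map_poly (\<lambda>z. z ^ r) h))) (\<beta> ^ j) =
        (\<beta> ^ j) ^ degree (map_poly (\<lambda>z. z ^ r) ?H) * poly (map_poly (\<lambda>z. z ^ r) ?H) (y ^ r)"
      using \<beta>0 by (simp add: map_poly_reflect_poly[OF \<iota>] poly_reflect_poly_nz yr)
    also have "poly (map_poly (\<lambda>z. z ^ r) ?H) (y ^ r) = 0"
      using poly_map_poly_embedding[OF frob] Hy field_embedding_0[OF frob] by simp
    finally show "poly (map_poly \<iota> (reflect_poly (map_poly (\<lambda>z. z ^ r) h))) (\<beta> ^ j) = 0" by simp
  qed
qed

section \<open>Self-duality and parameters of the code of length \<open>2 * n\<close>\<close>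

theorem theorem2:
  fixes \<iota> :: "'a::{field,finite} \<Rightarrow> 'b::{field,finite}"
    and \<beta> :: 'b
    and s q\<^sub>1 q m n d :: nat
    and \<delta> :: int
    and C C' :: "(nat \<Rightarrow> 'a) set"
    and g g\<^sub>H :: "'a poly"
  assumes "s \<ge> 1" and "q\<^sub>1 = 2 ^ s" and "q = q\<^sub>1 ^ 2" and "even m"
    and "CARD('a) = q" and "CARD('b) = q ^ m" and "field_embedding \<iota>"
    and "n = q ^ m - 1" and "primitive_root_of_unity n \<beta>"
    and "\<delta> = int q\<^sub>1 ^ (m + 1) - int q\<^sub>1 ^ 2 + 1" and "\<delta> \<ge> 2"
    and "C = bch_code \<iota> n \<delta> 1 \<beta>"
    and "g = generator_poly n C"
    and "g\<^sub>H = generator_poly n (hermitian_dual q\<^sub>1 n C)"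
    and "C' = code_generated_by (2 * n) (g * g\<^sub>H)"
    and "d = min (2 * min_dist n C) (min_dist n (euclidean_dual n C))"
  shows "cyclic_code (2 * n) C' \<and> is_generator_poly (2 * n) C' (g * g\<^sub>H)
    \<and> hermitian_self_dual q\<^sub>1 (2 * n) C'
    \<and> linear_code (2 * n) n d C'
    \<and> int d \<ge> int q\<^sub>1 ^ (m + 1) - int q\<^sub>1 ^ 2 + 1"
proof -
  note \<iota> = assms(7) and \<beta> = assms(9)
  \<comment> \<open>This is \<open>\<delta> - 1\<close>, the number of prescribed consecutive zeros,
    so the final bound reads \<open>k < d\<close>.\<close>
  define k where "k = q\<^sub>1 ^ (m + 1) - q\<^sub>1 ^ 2"
  have q1: "q\<^sub>1 \<ge> 2"
    using assms(1,2) by (metis one_le_numeral power_increasing power_one_right)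
  \<comment> \<open>For \<open>m = 0\<close> the formula gives
    \<open>\<delta> = q\<^sub>1 - q\<^sub>1 ^ 2 + 1 \<le> -1\<close>, against
    \<open>\<delta> \<ge> 2\<close>. With \<open>m > 0\<close> the natural subtraction defining
    \<open>k\<close> is exact.\<close>
  have m: "m > 0"
  proof (rule ccontr)
    assume "\<not> m > 0"
    then have "2 + int q\<^sub>1 * int q\<^sub>1 \<le> int q\<^sub>1 + 1"
      using assms(10,11) by (simp add: power2_eq_square)
    moreover have "int q\<^sub>1 * 2 \<le> int q\<^sub>1 * int q\<^sub>1" using q1 by (intro mult_left_mono) auto
    ultimately show False using q1 by linarith
  qed
  have "q\<^sub>1 ^ 2 \<le> q\<^sub>1 ^ (m + 1)" using q1 m by (intro power_increasing) auto
  then have k: "int k = int q\<^sub>1 ^ (m + 1) - int q\<^sub>1 ^ 2"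
    unfolding k_def by simp
  then have \<delta>: "\<delta> = int k + 1" and k1: "k \<ge> 1" using assms(10,11) by simp_all
  have n: "n = q\<^sub>1 ^ (2 * m) - 1" using assms(3,8) by (simp flip: power_mult)
  have card: "CARD('a) = q\<^sub>1 ^ 2" using assms(3,5) by simp
  have two: "(2 :: 'a) = 0"
    using assms(1,2) by (intro finite_field_two_eq_0) (simp add: card)
  have frob: "field_embedding (\<lambda>z::'a. z ^ q\<^sub>1)"
    unfolding assms(2) by (rule field_embedding_frobenius[OF two])
  have invol: "(z ^ q\<^sub>1) ^ q\<^sub>1 = z" for z :: 'a
    using finite_field_power_card[of z] by (simp add: card power2_eq_square flip: power_mult)
  have n0: "n > 0" using \<beta> by (simp add: primitive_root_of_unity_def)
  then have N0: "2 * n > 0" by simp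
  have odd: "odd n"
  proof -
    have "q\<^sub>1 ^ (2 * m) = Suc n" using q1 n by simp
    moreover have "even (q\<^sub>1 ^ (2 * m))" using assms(1,2) m by simp
    ultimately show ?thesis by simp
  qed
  define g\<^sub>0 where "g\<^sub>0 = monic_lcm ((\<lambda>i. min_poly \<iota> (\<beta> powi i)) ` {1..1 + \<delta> - 2})"
  have "\<beta> ^ n = 1" using \<beta> by (simp add: primitive_root_of_unity_def)
  note gen = bch_generator[OF \<iota> n0 this, of "{1..1 + \<delta> - 2}", folded g\<^sub>0_def]
  have C: "C = code_generated_by n g\<^sub>0"
    using assms(12) by (simp add: bch_code_def g\<^sub>0_def)
  have g: "g = g\<^sub>0"
    using assms(13) gen(1) by (simp add: C generator_poly_code[OF n0 gen(2)])
  have monic: "lead_coeff g = 1" and gM: "g dvd cyc_modulus n"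
    using gen(1,2) by (simp_all add: g)
  have Cg: "C = code_generated_by n g" by (simp add: C g)
  have zeros: "g dvd f \<longleftrightarrow> (\<forall>j. 1 \<le> j \<and> j \<le> k \<longrightarrow> poly (map_poly \<iota> f) (\<beta> ^ j) = 0)" for f
  proof -
    have "{1..1 + \<delta> - 2} = int ` {1..k}" by (simp only: \<delta> image_int_atLeastAtMost) simp
    then have "g dvd f \<longleftrightarrow> (\<forall>j\<in>{1..k}. poly (map_poly \<iota> f) (\<beta> powi int j) = 0)"
      using gen(3)[of f] by (simp only: g ball_simps)
    then show ?thesis by (simp only: power_int_of_nat Ball_def atLeastAtMost_iff)
  qed
  obtain h where gh: "g * h = cyc_modulus n" using gM by (metis dvdE)
  define h' where "h' = reflect_poly (map_poly (\<lambda>z. z ^ q\<^sub>1) h)"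
  define u where "u = inverse (lead_coeff h')"
  have h0: "h \<noteq> 0" using gh cyc_modulus_nonzero[OF n0, where ?'a = 'a] by auto
  then have u: "u \<noteq> 0" by (simp add: u_def h'_def map_poly_embedding_eq_0_iff[OF frob])
  note dual = hermitian_dual_code[OF n0 gh frob invol, folded h'_def Cg]
  have uh': "smult u h' dvd cyc_modulus n"
    unfolding h'_def
    by (rule hermitian_self_dual_repeated_root(1)[OF n0 two gh frob invol u refl])
  then have h'M: "h' dvd cyc_modulus n" using u by (simp add: smult_dvd_iff)
  have gH: "g\<^sub>H = smult u h'"
    using assms(14) by (simp add: dual generator_poly_code[OF n0 h'M] u_def)
  note self_dual = hermitian_self_dual_repeated_root[OF n0 two gh frob invol u gH[unfolded h'_def]]
  have monicH: "lead_coeff g\<^sub>H = 1"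
    using u by (simp add: gH u_def)
  have dualH: "hermitian_dual q\<^sub>1 n C = code_generated_by n g\<^sub>H"
    by (simp add: dual gH code_generated_by_smult[OF n0 h'M u])
  have "g dvd h'"
    unfolding h'_def
    by (rule bch_generator_dvd_conj_reciprocal[OF \<iota> assms(2,1,4) m card n \<beta> gh
          zeros[unfolded k_def]])
  then have ggH: "g dvd g\<^sub>H" by (simp add: gH dvd_smult)
  have nz: "g \<noteq> 0" "g\<^sub>H \<noteq> 0" 
    using monic monicH by (metis coeff_0 zero_neq_one)+
  have "h dvd cyc_modulus n" by (simp flip: gh)
  then have "degree h' = degree h"
    using coeff_0_dvd_cyc_modulus[OF n0, of h]
    by (simp add: h'_def coeff_map_poly_embedding[OF frob] field_embedding_eq_0_iff[OF frob]
        degree_map_poly_embedding[OF frob])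
  moreover have "degree g + degree h = n"
    using nz h0 gh n0 by (metis degree_cyc_modulus degree_mult_eq)
  ultimately have deg: "degree g + degree g\<^sub>H = n" using u by (simp add: gH)
  \<comment> \<open>A constant \<open>g\<close> would divide \<open>1\<close>, which does not vanish
    at \<open>\<beta>\<close>. The aim is \<open>degree g\<^sub>H < n\<close>: the dual code is then
    nonzero and its minimum distance is a genuine weight.\<close>
  have "degree g \<noteq> 0"
  proof
    assume "degree g = 0"
    with nz have "g dvd 1" by (simp add: is_unit_iff_degree)
    with k1 have "poly (map_poly \<iota> (1 :: 'a poly)) (\<beta> ^ 1) = 0" unfolding zeros by blast
    then show False by (simp add: field_embedding_1[OF \<iota>])
  qed
  with deg have degH: "degree g\<^sub>H < n" by simp
  have degg: "degree g < n"
    using deg dvd_imp_degree_le[OF ggH nz(2)] n0 by linarith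
  have lower: "k < min_dist n (code_generated_by n f)"
    if f: "f dvd cyc_modulus n" "degree f < n" "g dvd f" for f
  proof -
    obtain c where c: "c \<in> code_generated_by n f" "c \<noteq> 0"
      and min: "min_dist n (code_generated_by n f) = weight c"
      by (rule min_dist_attained[OF subspace_code_generated_by[OF n0 f(1)]
            code_generated_by_subset_words code_generated_by_nontrivial[OF n0 f(1,2)]])
    from c(1) have cw: "c \<in> words n" and "f dvd word_poly n c"
      by (simp_all add: code_generated_by_iff[OF n0 f(1)])
    with f(3) have "g dvd word_poly n c" by (metis dvd_trans)
    then have "poly (map_poly \<iota> (word_poly n c)) (\<beta> ^ j) = 0" if "1 \<le> j" "j \<le> k" for j
      using that unfolding zeros by blast
    then show ?thesis unfolding min by (rule bch_bound[OF \<iota> \<beta> cw c(2)])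
  qed
  have d: "d = min (2 * min_dist n (code_generated_by n g)) (min_dist n (code_generated_by n g\<^sub>H))"
    using assms(16) by (simp add: Cg[symmetric] dualH[symmetric] min_dist_hermitian_dual[OF frob invol])
  have "min_dist (2 * n) C' = d"
    unfolding assms(15) d
    by (rule min_dist_repeated_root[OF two odd ggH self_dual(1) degH])
  moreover have "degree (g * g\<^sub>H) = n" using nz deg by (simp add: degree_mult_eq)
  then have "word_space.dim C' = n"
    by (simp add: assms(15) dim_code_generated_by[OF N0 self_dual(2)])
  ultimately have "linear_code (2 * n) n d C'"
    using code_generated_by_subset_words[of "2 * n" "g * g\<^sub>H"]
      subspace_code_generated_by[OF N0 self_dual(2)]
    by (simp add: linear_code_def assms(15))
  moreover have "k < d"
    using lower[OF gM degg dvd_refl] lower[OF self_dual(1) degH ggH] by (simp add: d)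
  then have "int d \<ge> int q\<^sub>1 ^ (m + 1) - int q\<^sub>1 ^ 2 + 1" using k by linarith
  moreover have "is_generator_poly (2 * n) C' (g * g\<^sub>H)"
    unfolding assms(15)
    by (rule is_generator_poly_code[OF N0 self_dual(2)]) (simp add: lead_coeff_mult monic monicH)
  ultimately show ?thesis
    using cyclic_code_generated_by[OF N0 self_dual(2)] self_dual(3) by (simp add: assms(15))
qed

end
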